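(* Let $\Theta\subset\mathbb{R}^m$ be open, let $M=\mathbb{R}^d$, and let $T_\theta:M\to M$ ($\theta\in\Theta$) be a family of invertible maps, smooth with respect to the parameter $\theta$ and the variable $x$. Let $p\in\mathcal{P}$ be a reference probability measure on $M$ with positive density, assume $\int|T_\theta(x)|^2\,dp(x)<\infty$ for all $\theta\in\Theta$, and let $\rho_\theta$ be the density of the pushforward measure $(T_\theta)_{\#}p$. Suppose that $T_{\#}:\Theta\to\mathcal{P}$, $\theta\mapsto\rho_\theta$, is an isometric immersion from $\Theta$ to $\mathcal{P}$, where $\mathcal{P}$ carries the Wasserstein metric $g^W$, so that the metric tensor on $\Theta$ is the pullback $G=(T_{\#})^*g^W$. Then the metric tensor $G(\theta)$ at $\theta\in\Theta$ is an $m\times m$ non-negative definite symmetric matrix and can be computed as $$G(\theta)=\int \nabla\boldsymbol{\Psi}(T_\theta(x))\,\nabla\boldsymbol{\Psi}(T_\theta(x))^T\,dp(x),$$ or, entrywise, $$G_{ij}(\theta)=\int \nabla\psi_i(T_\theta(x))\cdot\nabla\psi_j(T_\theta(x))\,dp(x),\qquad 1\le i,j\le m.$$ Here $\boldsymbol{\Psi}=(\psi_1,\dots,\psi_m)^T$, $\nabla\boldsymbol{\Psi}$ is the $m\times d$ Jacobian matrix of $\boldsymbol{\Psi}$, and for each $k=1,\dots,m$ the function $\psi_k$ solves $$\nabla\cdot\big(\rho_\theta\nabla\psi_k(x)\big)=\nabla\cdot\big(\rho_\theta\,\partial_{\theta_k}T_\theta(T_\theta^{-1}(x))\big).$$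
   Context: $\mathcal{P}=\{\rho:\int\rho(x)\,dx=1,\ \rho(x)\ge0,\ \int|x|^2\rho(x)\,dx<\infty\}$ is the space of probability densities on $\mathbb{R}^d$ with finite second moment, regarded as an infinite-dimensional Riemannian manifold with tangent space $T_\rho\mathcal{P}=\{\dot\rho:\int\dot\rho(x)\,dx=0\}$ and Wasserstein metric tensor $$g^W(\rho)(\dot\rho_1,\dot\rho_2)=\int\nabla\psi_1(x)\cdot\nabla\psi_2(x)\,\rho(x)\,dx,\qquad \text{where } \dot\rho_i=-\nabla\cdot(\rho\nabla\psi_i),\ i=1,2.$$ For $\xi\in T_\theta\Theta\simeq\mathbb{R}^m$, the pushforward tangent vector $(T_{\#}|_\theta)_*\xi$ is $\frac{\partial}{\partial t}\rho_{\theta_t}\big|_{t=0}$ for any differentiable curve $\theta_t$ in $\Theta$ with $\theta_0=\theta$, $\dot\theta_0=\xi$. The pullback $G=(T_{\#})^*g^W$ is the bilinear form $G(\theta)(\xi,\eta)=g^W(\rho_\theta)\big((T_{\#}|_\theta)_*\xi,(T_{\#}|_\theta)_*\eta\big)$ on $T_\theta\Theta\simeq\mathbb{R}^m$, treated as an $m\times m$ matrix via $G(\theta)(\xi,\eta)=\xi^TG(\theta)\eta$. For a measurable map $T$ and a probability measure $\lambda$, $T_{\#}\lambda(E)=\lambda(T^{-1}(E))$ for all measurable $E$. Here $\partial_{\theta_k}T_\theta(T_\theta^{-1}(x))\in\mathbb{R}^d$ is the partial derivative of $T_\theta$ with respect to $\theta_k$, evaluated at the point $T_\theta^{-1}(x)$.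 *)

theory Defs
  imports "HOL-Probability.Probability"
begin

text \<open>
  \<open>Ck_on n S f\<close> is meant for open \<open>S\<close>: in finite dimension, \<open>f\<close> is of class \<open>C^n\<close> iff it is
  differentiable and all its directional derivatives \<open>\<lambda>x. Df(x) v\<close> are of class \<open>C^(n-1)\<close>.
\<close>

primrec Ck_on :: "nat \<Rightarrow> 'a::euclidean_space set \<Rightarrow> ('a \<Rightarrow> 'b::euclidean_space) \<Rightarrow> bool" where
  "Ck_on 0 S f \<longleftrightarrow> continuous_on S f"
| "Ck_on (Suc n) S f \<longleftrightarrow>
     (\<forall>x\<in>S. f differentiable (at x)) \<and>
     (\<forall>v. Ck_on n S (\<lambda>x. frechet_derivative f (at x) v))"

definition smooth_on :: "'a::euclidean_space set \<Rightarrow> ('a \<Rightarrow> 'b::euclidean_space) \<Rightarrow> bool" where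
  "smooth_on S f \<longleftrightarrow> (\<forall>n. Ck_on n S f)"

definition grad :: "(real ^ 'd \<Rightarrow> real) \<Rightarrow> real ^ 'd \<Rightarrow> real ^ 'd" where
  "grad f x = (\<chi> i. frechet_derivative f (at x) (axis i 1))"

definition param_deriv ::
  "(real ^ 'm \<Rightarrow> real ^ 'd \<Rightarrow> real ^ 'd) \<Rightarrow> 'm \<Rightarrow> real ^ 'm \<Rightarrow> real ^ 'd \<Rightarrow> real ^ 'd" where
  "param_deriv T k \<theta> y = vector_derivative (\<lambda>s. T (\<theta> + s *\<^sub>R axis k 1) y) (at 0)"

text \<open>
  Densities are only assumed measurable, so divergences and time derivatives of densities are
  taken in the weak sense. Divergences of locally integrable fields are distributions of order at
  most one, so \<open>C^1\<close> and \<open>C^\<infinity>\<close> functions of compact support are equivalent for testing them; for the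
  time derivatives of pushforward densities, the smoothness of the family of maps in the
  parameter has the same effect.
\<close>

definition test_functions :: "(real ^ 'd \<Rightarrow> real) set" where
  "test_functions = {\<phi>. Ck_on 1 UNIV \<phi> \<and> compact (closure (support_on UNIV \<phi>))}"

text \<open>The distribution \<open>\<nabla>\<cdot>F\<close>, evaluated at the test function \<open>\<phi>\<close>.\<close>

definition divergence :: "(real ^ 'd \<Rightarrow> real ^ 'd) \<Rightarrow> (real ^ 'd \<Rightarrow> real) \<Rightarrow> real" where
  "divergence F \<phi> = - (\<integral>x. F x \<bullet> grad \<phi> x \<partial>lborel)"

definition densities :: "(real ^ 'd \<Rightarrow> real) set" where
  "densities = {\<rho>. has_bochner_integral lborel \<rho> 1 \<and> (\<forall>x. 0 \<le> \<rho> x) \<and>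
     integrable lborel (\<lambda>x. (norm x)\<^sup>2 * \<rho> x)}"

definition tangent_space :: "(real ^ 'd \<Rightarrow> real) set" where
  "tangent_space = {\<sigma>. has_bochner_integral lborel \<sigma> 0}"

text \<open>
  Admissible potentials for the density \<open>\<rho>\<close>: the finiteness of \<open>\<integral>\<bar>\<nabla>\<psi>\<bar>\<^sup>2 \<rho> dx\<close> is what makes the
  integral defining the Wasserstein metric converge; without it, the equations
  \<open>\<sigma> = - \<nabla>\<cdot>(\<rho>\<nabla>\<psi>)\<close> below would not determine \<open>\<nabla>\<psi>\<close>.
\<close>

definition potentials :: "(real ^ 'd \<Rightarrow> real) \<Rightarrow> (real ^ 'd \<Rightarrow> real) set" where
  "potentials \<rho> = {\<psi>. Ck_on 1 UNIV \<psi> \<and> integrable lborel (\<lambda>x. (norm (grad \<psi> x))\<^sup>2 * \<rho> x)}"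

definition is_potential_of ::
  "(real ^ 'd \<Rightarrow> real) \<Rightarrow> (real ^ 'd \<Rightarrow> real) \<Rightarrow> (real ^ 'd \<Rightarrow> real) \<Rightarrow> bool" where
  "is_potential_of \<rho> \<sigma> \<psi> \<longleftrightarrow> \<psi> \<in> potentials \<rho> \<and>
     (\<forall>\<phi>\<in>test_functions. (\<integral>x. \<sigma> x * \<phi> x \<partial>lborel) = - divergence (\<lambda>x. \<rho> x *\<^sub>R grad \<psi> x) \<phi>)"

definition wasserstein_metric ::
  "(real ^ 'd \<Rightarrow> real) \<Rightarrow> (real ^ 'd \<Rightarrow> real) \<Rightarrow> (real ^ 'd \<Rightarrow> real) \<Rightarrow> real" where
  "wasserstein_metric \<rho> \<sigma>1 \<sigma>2 =
     (THE c. \<exists>\<psi>1 \<psi>2. is_potential_of \<rho> \<sigma>1 \<psi>1 \<and> is_potential_of \<rho> \<sigma>2 \<psi>2 \<and>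
        c = (\<integral>x. (grad \<psi>1 x \<bullet> grad \<psi>2 x) * \<rho> x \<partial>lborel))"

text \<open>\<open>\<sigma>\<close> is the derivative at time \<open>0\<close> of the curve of densities \<open>\<mu>\<close>.\<close>

definition has_velocity :: "(real \<Rightarrow> real ^ 'd \<Rightarrow> real) \<Rightarrow> (real ^ 'd \<Rightarrow> real) \<Rightarrow> bool" where
  "has_velocity \<mu> \<sigma> \<longleftrightarrow> (\<forall>\<phi>\<in>test_functions.
     ((\<lambda>t. \<integral>x. \<mu> t x * \<phi> x \<partial>lborel) has_real_derivative (\<integral>x. \<sigma> x * \<phi> x \<partial>lborel)) (at 0))"

definition is_pushforward_tangent ::
  "(real ^ 'm) set \<Rightarrow> (real ^ 'm \<Rightarrow> real ^ 'd \<Rightarrow> real) \<Rightarrow> real ^ 'm \<Rightarrow> real ^ 'm \<Rightarrow>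
   (real ^ 'd \<Rightarrow> real) \<Rightarrow> bool" where
  "is_pushforward_tangent \<Theta> \<rho> \<theta> \<xi> \<sigma> \<longleftrightarrow> \<sigma> \<in> tangent_space \<and>
     (\<forall>\<epsilon>>0. \<forall>\<gamma>. \<gamma> differentiable_on {-\<epsilon><..<\<epsilon>} \<and> \<gamma> ` {-\<epsilon><..<\<epsilon>} \<subseteq> \<Theta> \<and>
        \<gamma> 0 = \<theta> \<and> (\<gamma> has_vector_derivative \<xi>) (at 0) \<longrightarrow> has_velocity (\<lambda>t. \<rho> (\<gamma> t)) \<sigma>)"

text \<open>
  Pushforward tangent vectors are unique up to modification on a null set, which affects neither
  their potentials nor the Wasserstein metric; hence the choice below is harmless.
\<close>

definition pushforward_tangent ::
  "(real ^ 'm) set \<Rightarrow> (real ^ 'm \<Rightarrow> real ^ 'd \<Rightarrow> real) \<Rightarrow> real ^ 'm \<Rightarrow> real ^ 'm \<Rightarrow>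
   real ^ 'd \<Rightarrow> real" where
  "pushforward_tangent \<Theta> \<rho> \<theta> \<xi> = (SOME \<sigma>. is_pushforward_tangent \<Theta> \<rho> \<theta> \<xi> \<sigma>)"

definition pullback_metric ::
  "(real ^ 'm) set \<Rightarrow> (real ^ 'm \<Rightarrow> real ^ 'd \<Rightarrow> real) \<Rightarrow> real ^ 'm \<Rightarrow>
   real ^ 'm \<Rightarrow> real ^ 'm \<Rightarrow> real" where
  "pullback_metric \<Theta> \<rho> \<theta> \<xi> \<eta> =
     wasserstein_metric (\<rho> \<theta>) (pushforward_tangent \<Theta> \<rho> \<theta> \<xi>) (pushforward_tangent \<Theta> \<rho> \<theta> \<eta>)"

text \<open>
  In an immersion into the Wasserstein space, the pushforward tangent vectors exist, possess
  potentials (i.e. the metric tensor is defined on them), and depend injectively on \<open>\<xi>\<close>.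
\<close>

definition wasserstein_immersion ::
  "(real ^ 'm) set \<Rightarrow> (real ^ 'm \<Rightarrow> real ^ 'd \<Rightarrow> real) \<Rightarrow> bool" where
  "wasserstein_immersion \<Theta> \<rho> \<longleftrightarrow> (\<forall>\<theta>\<in>\<Theta>. \<rho> \<theta> \<in> densities \<and>
     (\<forall>\<xi>. \<exists>\<sigma> \<psi>. is_pushforward_tangent \<Theta> \<rho> \<theta> \<xi> \<sigma> \<and> is_potential_of (\<rho> \<theta>) \<sigma> \<psi>) \<and>
     (\<forall>\<xi> \<eta> \<sigma>. is_pushforward_tangent \<Theta> \<rho> \<theta> \<xi> \<sigma> \<and> is_pushforward_tangent \<Theta> \<rho> \<theta> \<eta> \<sigma> \<longrightarrow> \<xi> = \<eta>))"

text \<open>\<open>G\<close> is the metric tensor on \<open>\<Theta>\<close>, as a bilinear form at each point.\<close>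

definition isometric_wasserstein_immersion ::
  "(real ^ 'm) set \<Rightarrow> (real ^ 'm \<Rightarrow> real ^ 'm \<Rightarrow> real ^ 'm \<Rightarrow> real) \<Rightarrow>
   (real ^ 'm \<Rightarrow> real ^ 'd \<Rightarrow> real) \<Rightarrow> bool" where
  "isometric_wasserstein_immersion \<Theta> G \<rho> \<longleftrightarrow> wasserstein_immersion \<Theta> \<rho> \<and>
     (\<forall>\<theta>\<in>\<Theta>. \<forall>\<xi> \<eta>. G \<theta> \<xi> \<eta> = pullback_metric \<Theta> \<rho> \<theta> \<xi> \<eta>)"

definition form_matrix :: "(real ^ 'm \<Rightarrow> real ^ 'm \<Rightarrow> real) \<Rightarrow> real ^ 'm ^ 'm" where
  "form_matrix B = (\<chi> i j. B (axis i 1) (axis j 1))"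

definition solves_potential_equation ::
  "(real ^ 'm \<Rightarrow> real ^ 'd \<Rightarrow> real ^ 'd) \<Rightarrow> (real ^ 'd \<Rightarrow> real) \<Rightarrow> real ^ 'm \<Rightarrow> 'm \<Rightarrow>
   (real ^ 'd \<Rightarrow> real) \<Rightarrow> bool" where
  "solves_potential_equation T \<rho> \<theta> k \<psi> \<longleftrightarrow> \<psi> \<in> potentials \<rho> \<and>
     (\<forall>\<phi>\<in>test_functions. divergence (\<lambda>x. \<rho> x *\<^sub>R grad \<psi> x) \<phi> =
        divergence (\<lambda>x. \<rho> x *\<^sub>R param_deriv T k \<theta> (inv (T \<theta>) x)) \<phi>)"

end

theory Submission
  imports Defs
begin

text \<open>
  A vector field in \<open>L\<^sup>2(\<rho>)\<close> whose \<open>\<rho>\<close>-weighted divergence vanishes weakly is orthogonal in \<open>L\<^sup>2(\<rho>)\<close>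
  to the gradient of every potential, so that the Wasserstein metric may be computed with any choice
  of potentials. Differentiating \<open>\<integral>\<phi> \<rho>\<^sub>\<theta> dx = \<integral>\<phi>(T\<^sub>\<theta> y) dp(y)\<close> under the integral along straight lines
  shows that the pushforward tangent vector of \<open>\<xi>\<close> is \<open>-\<Sum>\<^sub>k \<xi>\<^sub>k \<nabla>\<cdot>(\<rho>\<^sub>\<theta> \<partial>\<^sub>k T\<^sub>\<theta> \<circ> T\<^sub>\<theta>\<inverse>)\<close>; hence
  \<open>\<Sum>\<^sub>k \<xi>\<^sub>k \<psi>\<^sub>k\<close> is a potential of it, and the pullback is the Gram matrix of the \<open>\<nabla>\<psi>\<^sub>k\<close> in \<open>L\<^sup>2(\<rho>\<^sub>\<theta>)\<close>.
\<close>

subsection \<open>Gradients of functions of class \<open>C\<^sup>1\<close>\<close>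

lemma grad_eqI:
  assumes "(f has_derivative (\<lambda>h. g \<bullet> h)) (at x)"
  shows "grad f x = g"
  by (simp add: grad_def vec_eq_iff inner_axis flip: frechet_derivative_at[OF assms])

lemma differentiable_has_derivative_grad:
  fixes f :: "real ^ 'd \<Rightarrow> real"
  assumes "f differentiable (at x)"
  shows "(f has_derivative (\<lambda>h. grad f x \<bullet> h)) (at x)"
proof -
  have D: "(f has_derivative frechet_derivative f (at x)) (at x)"
    using assms frechet_derivative_works by blast
  then have l: "linear (frechet_derivative f (at x))"
    by (rule has_derivative_linear)
  have "frechet_derivative f (at x) h = grad f x \<bullet> h" for h
  proof -
    have "frechet_derivative f (at x) h = frechet_derivative f (at x) (\<Sum>i\<in>UNIV. h $ i *\<^sub>R axis i 1)"
      by (simp add: basis_expansion scalar_mult_eq_scaleR[symmetric])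
    also have "\<dots> = grad f x \<bullet> h"
      by (simp add: linear_sum[OF l] linear_scale[OF l] grad_def inner_vec_def mult.commute)
    finally show ?thesis .
  qed
  then have "frechet_derivative f (at x) = (\<lambda>h. grad f x \<bullet> h)" by auto
  with D show ?thesis by simp
qed

lemma C1_has_derivative_grad:
  "Ck_on 1 UNIV f \<Longrightarrow> (f has_derivative (\<lambda>h. grad f x \<bullet> h)) (at x)"
  by (simp add: differentiable_has_derivative_grad)

lemma C1_continuous_grad:
  assumes "Ck_on 1 UNIV f"
  shows "continuous_on UNIV (grad f)"
  using assms unfolding grad_def by (auto intro!: continuous_on_vec_lambda)

lemma C1_continuous: "Ck_on 1 UNIV f \<Longrightarrow> continuous_on UNIV f"
  by (simp add: continuous_on_eq_continuous_within differentiable_imp_continuous_within)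

lemma C1I:
  fixes f :: "real ^ 'd \<Rightarrow> real"
  assumes "\<And>x. (f has_derivative (\<lambda>h. g x \<bullet> h)) (at x)" "continuous_on UNIV g"
  shows "Ck_on 1 UNIV f"
proof -
  have "frechet_derivative f (at x) = (\<lambda>h. g x \<bullet> h)" for x
    using frechet_derivative_at[OF assms(1)] by simp
  with assms show ?thesis
    by (auto simp: differentiable_def intro!: continuous_intros)
qed

text \<open>Squaring removes the kink of the positive part: at 0 the difference quotient is bounded
  by \<open>\<bar>h\<bar>\<close>. This makes \<open>cutoff\<close> a function of class C^1.\<close>

lemma DERIV_max_0_power2:
  "((\<lambda>s::real. (max 0 s)\<^sup>2) has_real_derivative 2 * max 0 s) (at s)"
proof -
  consider "s > 0" | "s < 0" | "s = 0" by linarith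
  then show ?thesis
  proof cases
    case 1
    have "((\<lambda>s::real. s\<^sup>2) has_real_derivative 2 * max 0 s) (at s)"
      using 1 by (auto intro!: derivative_eq_intros)
    then show ?thesis
      by (rule has_field_derivative_transform_within_open[where S="{0<..}"]) (use 1 in auto)
  next
    case 2
    have "((\<lambda>s::real. 0) has_real_derivative 2 * max 0 s) (at s)"
      using 2 by (auto intro!: derivative_eq_intros)
    then show ?thesis
      by (rule has_field_derivative_transform_within_open[where S="{..<0}"]) (use 2 in auto)
  next
    case 3
    have "((\<lambda>h::real. (max 0 h)\<^sup>2 / h) \<longlongrightarrow> 0) (at 0)"
    proof (rule Lim_null_comparison)
      show "\<forall>\<^sub>F h in at (0::real). norm ((max 0 h)\<^sup>2 / h) \<le> \<bar>h\<bar>"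
        by (rule always_eventually) (auto simp: max_def power2_eq_square)
      show "((\<lambda>h::real. \<bar>h\<bar>) \<longlongrightarrow> 0) (at 0)"
        by (auto intro!: tendsto_eq_intros)
    qed
    then show ?thesis by (simp add: DERIV_def 3)
  qed
qed

subsection \<open>Divergence-free fields and gradients\<close>

text \<open>For \<open>R > 0\<close>, a radial bump living on the ball of radius \<open>R\<close>
  that increases pointwise to 1 as \<open>R\<close> grows. C^1 regularity is all that
  \<open>test_functions\<close> asks for, so a squared truncated polynomial serves.\<close>

definition cutoff :: "real \<Rightarrow> real ^ 'd \<Rightarrow> real" where
  "cutoff R x = (max 0 (1 - x \<bullet> x / R\<^sup>2))\<^sup>2"

definition cutoff_grad :: "real \<Rightarrow> real ^ 'd \<Rightarrow> real ^ 'd" where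
  "cutoff_grad R x = (- 4 * max 0 (1 - x \<bullet> x / R\<^sup>2) / R\<^sup>2) *\<^sub>R x"

lemma cutoff_has_derivative:
  "(cutoff R has_derivative (\<lambda>h. cutoff_grad R x \<bullet> h)) (at x)"
proof -
  have 1: "((\<lambda>x. 1 - x \<bullet> x / R\<^sup>2) has_derivative (\<lambda>h. - (2 * (x \<bullet> h)) / R\<^sup>2)) (at x)"
    unfolding divide_inverse
    by (rule derivative_eq_intros refl)+ (auto simp: fun_eq_iff inner_commute algebra_simps)
  show ?thesis
    unfolding cutoff_def[abs_def]
    using has_derivative_compose[OF 1 DERIV_max_0_power2[unfolded has_field_derivative_def]]
    by (rule back_subst[where P="\<lambda>f. (_ has_derivative f) _"]) (auto simp: cutoff_grad_def)
qed

lemma continuous_cutoff_grad: "continuous_on UNIV (cutoff_grad R)"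
  unfolding cutoff_grad_def[abs_def] divide_inverse by (intro continuous_intros)

lemma cutoff_bounds: "0 \<le> cutoff R x" "cutoff R x \<le> 1"
  by (auto simp: cutoff_def power_le_one)

lemma cutoff_eq_0:
  assumes "R > 0" "norm x \<ge> R"
  shows "cutoff R x = 0" "cutoff_grad R x = 0"
proof -
  have "R\<^sup>2 \<le> x \<bullet> x"
    using assms power_mono[of R "norm x" 2] by (simp add: power2_norm_eq_inner)
  then have "1 - x \<bullet> x / R\<^sup>2 \<le> 0" using assms by (simp add: field_simps)
  then have "max 0 (1 - x \<bullet> x / R\<^sup>2) = 0" by simp
  then show "cutoff R x = 0" "cutoff_grad R x = 0"
    unfolding cutoff_def cutoff_grad_def by simp_all
qed

text \<open>Inside the ball the truncated factor is at most 1 and \<open>norm x\<close> is at most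
  \<open>R\<close>, leaving \<open>4 * R / R\<^sup>2\<close>; outside, the gradient vanishes. The
  decay in \<open>R\<close> later beats the growth of the truncated potential.\<close>

lemma norm_cutoff_grad:
  assumes "R > 0"
  shows "norm (cutoff_grad R x) \<le> 4 / R"
proof (cases "norm x \<ge> R")
  case True
  then show ?thesis using cutoff_eq_0(2)[OF assms True] assms by simp
next
  case False
  let ?m = "max 0 (1 - x \<bullet> x / R\<^sup>2)"
  have "norm (cutoff_grad R x) = 4 * (?m * norm x) / R\<^sup>2"
    by (simp add: cutoff_grad_def)
  also have "?m * norm x \<le> 1 * R"
    using False assms by (intro mult_mono) auto
  finally show ?thesis using assms by (simp add: power2_eq_square divide_right_mono field_simps)
qed

lemma test_functionsI:
  assumes "Ck_on 1 UNIV f" "\<And>x. norm x \<ge> R \<Longrightarrow> f x = 0"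
  shows "f \<in> test_functions"
proof -
  have "support_on UNIV f \<subseteq> cball 0 R"
    using assms(2) by (force simp: support_on_def)
  then have "bounded (support_on UNIV f)"
    using bounded_cball bounded_subset by blast
  with assms(1) show ?thesis by (simp add: test_functions_def)
qed

section \<open>Integrability of products of fields in L^2(\<open>\<rho>\<close>)\<close>

text \<open>The product of two L^2(\<open>\<rho>\<close>) functions is dominated by the sum of their
  squares. Constants may stand for \<open>f\<close> when \<open>\<rho>\<close> is
  integrable.\<close>

lemma integrable_norm_mult_density:
  fixes F :: "real ^ 'd \<Rightarrow> real ^ 'd" and f :: "real ^ 'd \<Rightarrow> real"
  assumes [measurable]: "\<rho> \<in> borel_measurable borel" "F \<in> borel_measurable borel" "f \<in> borel_measurable borel"
    and nonneg: "\<And>x. 0 \<le> \<rho> x"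
    and F: "integrable lborel (\<lambda>x. (norm (F x))\<^sup>2 * \<rho> x)"
    and f: "integrable lborel (\<lambda>x. (f x)\<^sup>2 * \<rho> x)"
  shows "integrable lborel (\<lambda>x. norm (F x) * f x * \<rho> x)"
proof (rule Bochner_Integration.integrable_bound[OF Bochner_Integration.integrable_add[OF F f]])
  show "AE x in lborel. norm (norm (F x) * f x * \<rho> x) \<le> norm ((norm (F x))\<^sup>2 * \<rho> x + (f x)\<^sup>2 * \<rho> x)"
  proof (intro AE_I2)
    fix x
    have "norm (F x) * \<bar>f x\<bar> \<le> (norm (F x))\<^sup>2 + (f x)\<^sup>2"
      using sum_squares_bound[of "norm (F x)" "\<bar>f x\<bar>"] mult_nonneg_nonneg[of "norm (F x)" "\<bar>f x\<bar>"]
      by (simp del: mult_nonneg_nonneg)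
    from mult_right_mono[OF this nonneg[of x]]
    show "norm (norm (F x) * f x * \<rho> x) \<le> norm ((norm (F x))\<^sup>2 * \<rho> x + (f x)\<^sup>2 * \<rho> x)"
      using nonneg[of x] by (simp add: abs_mult algebra_simps)
  qed
qed measurable

lemma integrable_inner_mult_density:
  fixes F H :: "real ^ 'd \<Rightarrow> real ^ 'd"
  assumes [measurable]: "\<rho> \<in> borel_measurable borel" "F \<in> borel_measurable borel" "H \<in> borel_measurable borel"
    and nonneg: "\<And>x. 0 \<le> \<rho> x"
    and F: "integrable lborel (\<lambda>x. (norm (F x))\<^sup>2 * \<rho> x)"
    and H: "integrable lborel (\<lambda>x. (norm (H x))\<^sup>2 * \<rho> x)"
  shows "integrable lborel (\<lambda>x. (F x \<bullet> H x) * \<rho> x)"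
proof (rule Bochner_Integration.integrable_bound)
  show "integrable lborel (\<lambda>x. norm (F x) * norm (H x) * \<rho> x)"
    by (rule integrable_norm_mult_density) (use assms in auto)
  show "AE x in lborel. norm ((F x \<bullet> H x) * \<rho> x) \<le> norm (norm (F x) * norm (H x) * \<rho> x)"
    using nonneg by (auto simp: abs_mult Cauchy_Schwarz_ineq2 mult_right_mono)
qed measurable

lemma potentials_measurable_grad:
  "\<psi> \<in> potentials \<rho> \<Longrightarrow> grad \<psi> \<in> borel_measurable borel"
  by (auto simp: potentials_def intro!: borel_measurable_continuous_onI C1_continuous_grad simp del: Ck_on.simps One_nat_def)

text \<open>
  Test with \<open>\<psi>\<close>, truncated in the domain at radius \<open>N\<^sup>2\<close> and in the range by \<open>N arctan (\<psi> / N)\<close>: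
  the error term from the cutoff is of order \<open>1 / N\<close>.
\<close>

lemma divergence_free_orthogonal_grad:
  fixes F :: "real ^ 'd \<Rightarrow> real ^ 'd"
  assumes \<rho>: "integrable lborel \<rho>" and nonneg: "\<And>x. 0 \<le> \<rho> x"
    and [measurable]: "F \<in> borel_measurable borel"
    and F: "integrable lborel (\<lambda>x. (norm (F x))\<^sup>2 * \<rho> x)"
    and div: "\<And>\<phi>. \<phi> \<in> test_functions \<Longrightarrow> divergence (\<lambda>x. \<rho> x *\<^sub>R F x) \<phi> = 0"
    and \<psi>: "\<psi> \<in> potentials \<rho>"
  shows "(\<integral>x. (F x \<bullet> grad \<psi> x) * \<rho> x \<partial>lborel) = 0"
proof -
  have C1: "Ck_on 1 UNIV \<psi>" and int: "integrable lborel (\<lambda>x. (norm (grad \<psi> x))\<^sup>2 * \<rho> x)"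
    using \<psi> unfolding potentials_def by auto
  note dpsi = C1_has_derivative_grad[OF C1]
  note cont[continuous_intros] = C1_continuous[OF C1] C1_continuous_grad[OF C1]
    continuous_cutoff_grad
  have [measurable]: "\<rho> \<in> borel_measurable borel"
    using \<rho> by (simp add: borel_measurable_integrable)
  have [measurable]: "grad \<psi> \<in> borel_measurable borel"
    using \<psi> by (rule potentials_measurable_grad)
  \<comment> \<open>Starting at 1 avoids division by zero and gives
    \<open>8 / N n \<le> 8\<close>.\<close>
  define N where "N n = real (Suc n)" for n
  have N: "N n \<ge> 1" "N n > 0" "N n \<noteq> 0" for n by (auto simp: N_def)
  \<comment> \<open>No growth bound on \<open>\<psi>\<close> is available, only on its gradient.
    This truncation is bounded by a multiple of \<open>N n\<close>, and its gradient is
    \<open>b n x *\<^sub>R grad \<psi> x\<close> with a factor between 0 and 1 that tends to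
    1.\<close>
  define a where "a n x = N n * arctan (\<psi> x / N n)" for n x
  define b where "b n x = 1 / (1 + (\<psi> x / N n)\<^sup>2)" for n x
  \<comment> \<open>The product rule gradient of \<open>cutoff ((N n)\<^sup>2) x * a n x\<close>:
    first the error term, then the main term.\<close>
  define g where "g n x = a n x *\<^sub>R cutoff_grad ((N n)\<^sup>2) x + (cutoff ((N n)\<^sup>2) x * b n x) *\<^sub>R grad \<psi> x" for n x
  have sq: "1 + (\<psi> x / N n)\<^sup>2 > 0" for n x by (simp add: add_pos_nonneg)
  have der_a: "(a n has_derivative (\<lambda>h. (b n x *\<^sub>R grad \<psi> x) \<bullet> h)) (at x)" for n x
  proof -
    have "((\<lambda>x. \<psi> x / N n) has_derivative (\<lambda>h. (grad \<psi> x \<bullet> h) / N n)) (at x)"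
      unfolding divide_inverse by (intro has_derivative_mult_left dpsi)
    moreover have "((\<lambda>s. N n * arctan s) has_real_derivative N n * b n x) (at (\<psi> x / N n))"
      by (auto intro!: derivative_eq_intros simp: b_def divide_inverse)
    ultimately have "((\<lambda>x. N n * arctan (\<psi> x / N n)) has_derivative
        (\<lambda>h. N n * b n x * ((grad \<psi> x \<bullet> h) / N n))) (at x)"
      unfolding has_field_derivative_def by (rule has_derivative_compose)
    then show ?thesis
      unfolding a_def[abs_def]
      by (rule back_subst[where P="\<lambda>f. (_ has_derivative f) _"]) (auto simp: N)
  qed
  have der: "((\<lambda>x. cutoff ((N n)\<^sup>2) x * a n x) has_derivative (\<lambda>h. g n x \<bullet> h)) (at x)" for n x
    by (rule back_subst[where P="\<lambda>f. (_ has_derivative f) _"],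
        rule has_derivative_mult[OF cutoff_has_derivative der_a])
       (auto simp: g_def fun_eq_iff algebra_simps inner_add_left)
  have cont_g: "continuous_on UNIV (g n)" for n
    unfolding g_def a_def b_def cutoff_def divide_inverse[of _ "N n"] divide_inverse[of _ "((N n)\<^sup>2)\<^sup>2"]
    by (intro continuous_intros) (use sq in \<open>auto simp: divide_inverse less_imp_neq[THEN not_sym] dest: spec\<close>)
  have test: "(\<lambda>x. cutoff ((N n)\<^sup>2) x * a n x) \<in> test_functions" for n
    by (rule test_functionsI[OF C1I[OF der cont_g], where R="(N n)\<^sup>2"])
       (use N in \<open>auto simp: cutoff_eq_0\<close>)
  have "(\<integral>x. (F x \<bullet> g n x) * \<rho> x \<partial>lborel) = 0" for n
    using div[OF test[of n]] unfolding divergence_def grad_eqI[OF der] by (simp add: mult.commute)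
  moreover have "(\<lambda>n. \<integral>x. (F x \<bullet> g n x) * \<rho> x \<partial>lborel) \<longlonglongrightarrow> (\<integral>x. (F x \<bullet> grad \<psi> x) * \<rho> x \<partial>lborel)"
  proof (rule integral_dominated_convergence)
    \<comment> \<open>The 8 absorbs the error term for all \<open>n\<close> at once; its
      contribution is integrable because \<open>\<rho>\<close> has finite mass.\<close>
    show "integrable lborel (\<lambda>x. norm (F x) * (8 + norm (grad \<psi> x)) * \<rho> x)"
    proof -
      have "integrable lborel (\<lambda>x. norm (F x) * 8 * \<rho> x + norm (F x) * norm (grad \<psi> x) * \<rho> x)"
        using F int \<rho> nonneg by (intro Bochner_Integration.integrable_add integrable_norm_mult_density) auto
      then show ?thesis by (simp add: algebra_simps)
    qed
    \<comment> \<open>Since pi / 2 < 2, \<open>a n\<close> is bounded by \<open>2 * N n\<close>. The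
      radius \<open>(N n)\<^sup>2\<close> gives a cutoff gradient of at most
      \<open>4 / (N n)\<^sup>2\<close>, so the product tends to 0; with radius \<open>N n\<close>
      this estimate would only give a constant.\<close>
    have err: "norm (a n x *\<^sub>R cutoff_grad ((N n)\<^sup>2) x) \<le> 8 / N n" for n x
    proof -
      have "\<bar>arctan (\<psi> x / N n)\<bar> \<le> 2"
        using arctan_bounded[of "\<psi> x / N n"] pi_less_4 by linarith
      then have "\<bar>a n x\<bar> \<le> N n * 2"
        using N[of n] by (simp add: a_def abs_mult)
      then have "norm (a n x *\<^sub>R cutoff_grad ((N n)\<^sup>2) x) \<le> (N n * 2) * (4 / (N n)\<^sup>2)"
        using norm_cutoff_grad[of "(N n)\<^sup>2" x] N[of n] by (simp only: norm_scaleR, intro mult_mono) auto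
      also have "\<dots> = 8 / N n" using N[of n] by (simp add: power2_eq_square)
      finally show ?thesis .
    qed
    have b: "0 \<le> b n x" "b n x \<le> 1" for n x
      using sq[where n=n and x=x] by (auto simp: b_def)
    show "AE x in lborel. norm ((F x \<bullet> g n x) * \<rho> x) \<le> norm (F x) * (8 + norm (grad \<psi> x)) * \<rho> x" for n
    proof (rule AE_I2)
      fix x
      have "norm (g n x) \<le> 8 / N n + 1 * norm (grad \<psi> x)"
        unfolding g_def
      proof (rule norm_triangle_mono[OF err])
        have "\<bar>cutoff ((N n)\<^sup>2) x * b n x\<bar> \<le> 1"
          using b[where n=n and x=x] cutoff_bounds[of "(N n)\<^sup>2" x] by (simp add: abs_mult mult_le_one)
        then show "norm ((cutoff ((N n)\<^sup>2) x * b n x) *\<^sub>R grad \<psi> x) \<le> 1 * norm (grad \<psi> x)"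
          unfolding norm_scaleR by (intro mult_right_mono) auto
      qed
      also have "8 / N n \<le> 8" using N[of n] by (simp add: field_simps)
      finally have "norm (g n x) \<le> 8 + norm (grad \<psi> x)" by simp
      then have "\<bar>F x \<bullet> g n x\<bar> \<le> norm (F x) * (8 + norm (grad \<psi> x))"
        by (meson Cauchy_Schwarz_ineq2 mult_left_mono norm_ge_zero order_trans)
      then show "norm ((F x \<bullet> g n x) * \<rho> x) \<le> norm (F x) * (8 + norm (grad \<psi> x)) * \<rho> x"
        using nonneg[of x] by (simp add: abs_mult mult_right_mono)
    qed
    have Ntop: "filterlim N at_top sequentially"
      unfolding N_def by (rule filterlim_compose[OF filterlim_real_sequentially filterlim_Suc])
    \<comment> \<open>The limit is written with the same shape as \<open>g\<close>, so that the
      limit rules split it into error term, cutoff and \<open>b\<close>.\<close>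
    have "(\<lambda>n. g n x) \<longlonglongrightarrow> 0 + (1 * 1) *\<^sub>R grad \<psi> x" for x
      unfolding g_def
    proof (intro tendsto_add tendsto_scaleR tendsto_mult tendsto_const)
      show "(\<lambda>n. a n x *\<^sub>R cutoff_grad ((N n)\<^sup>2) x) \<longlonglongrightarrow> 0"
      proof (rule Lim_null_comparison)
        show "\<forall>\<^sub>F n in sequentially. norm (a n x *\<^sub>R cutoff_grad ((N n)\<^sup>2) x) \<le> 8 / N n"
          by (intro always_eventually allI err)
        show "(\<lambda>n. 8 / N n) \<longlonglongrightarrow> 0"
          by (rule real_tendsto_divide_at_top[OF tendsto_const Ntop])
      qed
      have "(\<lambda>n. \<psi> x / N n) \<longlonglongrightarrow> 0"
        by (rule real_tendsto_divide_at_top[OF tendsto_const Ntop])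
      then have "(\<lambda>n. 1 / (1 + (\<psi> x / N n)\<^sup>2)) \<longlonglongrightarrow> 1 / (1 + 0\<^sup>2)"
        by (intro tendsto_intros) auto
      then show "(\<lambda>n. b n x) \<longlonglongrightarrow> 1" by (simp add: b_def)
      have "(\<lambda>n. x \<bullet> x / ((N n)\<^sup>2)\<^sup>2) \<longlonglongrightarrow> 0"
        by (intro real_tendsto_divide_at_top[OF tendsto_const] filterlim_pow_at_top Ntop) auto
      then have "(\<lambda>n. (max 0 (1 - x \<bullet> x / ((N n)\<^sup>2)\<^sup>2))\<^sup>2) \<longlonglongrightarrow> (max 0 (1 - 0))\<^sup>2"
        by (intro tendsto_intros)
      then show "(\<lambda>n. cutoff ((N n)\<^sup>2) x) \<longlonglongrightarrow> 1" by (simp add: cutoff_def)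
    qed
    then show "AE x in lborel. (\<lambda>n. (F x \<bullet> g n x) * \<rho> x) \<longlonglongrightarrow> (F x \<bullet> grad \<psi> x) * \<rho> x"
      by (intro AE_I2 tendsto_intros) auto
    show "(\<lambda>x. (F x \<bullet> g n x) * \<rho> x) \<in> borel_measurable lborel" for n
      using borel_measurable_continuous_onI[OF cont_g[of n]] by measurable
  qed measurable
  ultimately show ?thesis
    by (simp add: LIMSEQ_const_iff)
qed

subsection \<open>The Wasserstein metric in terms of potentials\<close>

lemma C1_weighted_sum:
  fixes f :: "'k \<Rightarrow> real ^ 'd \<Rightarrow> real"
  assumes "\<And>k. k \<in> I \<Longrightarrow> Ck_on 1 UNIV (f k)"
  shows "Ck_on 1 UNIV (\<lambda>x. \<Sum>k\<in>I. c k * f k x)"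
    and "grad (\<lambda>x. \<Sum>k\<in>I. c k * f k x) x = (\<Sum>k\<in>I. c k *\<^sub>R grad (f k) x)"
proof -
  have der: "((\<lambda>x. \<Sum>k\<in>I. c k * f k x) has_derivative
      (\<lambda>h. (\<Sum>k\<in>I. c k *\<^sub>R grad (f k) x) \<bullet> h)) (at x)" for x
    unfolding inner_sum_left inner_scaleR_left
    by (intro has_derivative_sum has_derivative_mult_right C1_has_derivative_grad assms)
  show "Ck_on 1 UNIV (\<lambda>x. \<Sum>k\<in>I. c k * f k x)"
    by (rule C1I[OF der]) (intro continuous_intros C1_continuous_grad assms)
  show "grad (\<lambda>x. \<Sum>k\<in>I. c k * f k x) x = (\<Sum>k\<in>I. c k *\<^sub>R grad (f k) x)"
    by (rule grad_eqI[OF der])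
qed

lemma grad_outside_support:
  assumes "x \<notin> closure (support_on UNIV f)"
  shows "grad f x = 0"
proof (rule grad_eqI)
  have "((\<lambda>x. 0) has_derivative (\<lambda>h. 0 \<bullet> h)) (at x)" by simp
  then show "(f has_derivative (\<lambda>h. 0 \<bullet> h)) (at x)"
  proof (rule has_derivative_transform_within_open)
    show "open (- closure (support_on UNIV f))" by auto
    show "0 = f y" if "y \<in> - closure (support_on UNIV f)" for y
      using that closure_subset[of "support_on UNIV f"] by (auto simp: support_on_def)
  qed (use assms in auto)
qed

lemma test_function_bounds:
  assumes "\<phi> \<in> test_functions"
  obtains B where "\<And>x. \<bar>\<phi> x\<bar> \<le> B" "\<And>x. norm (grad \<phi> x) \<le> B"
proof -
  let ?K = "closure (support_on UNIV \<phi>)"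
  have C1: "Ck_on 1 UNIV \<phi>" and K: "compact ?K"
    using assms unfolding test_functions_def by auto
  have "bounded (\<phi> ` ?K)" "bounded (grad \<phi> ` ?K)"
    using K C1_continuous[OF C1] C1_continuous_grad[OF C1]
    by (auto intro!: compact_imp_bounded compact_continuous_image intro: continuous_on_subset)
  then obtain B1 B2 where B: "\<And>x. x \<in> ?K \<Longrightarrow> norm (\<phi> x) \<le> B1" "B1 > 0"
      "\<And>x. x \<in> ?K \<Longrightarrow> norm (grad \<phi> x) \<le> B2" "B2 > 0"
    unfolding bounded_pos by (metis imageI)
  have "\<phi> x = 0" if "x \<notin> ?K" for x
    using that closure_subset[of "support_on UNIV \<phi>"] by (auto simp: support_on_def)
  with B show thesis
    by (intro that[of "max B1 B2"]) (metis grad_outside_support le_max_iff_disj less_imp_le norm_zero real_norm_def)+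
qed

text \<open>A bounded gradient has finite energy against a density of finite mass. Pairings of
  potentials with test functions are therefore integrable, which linearity of the Bochner integral
  requires.\<close>

lemma test_functions_subset_potentials:
  fixes \<rho> :: "real ^ 'd \<Rightarrow> real"
  assumes "integrable lborel \<rho>" "\<And>x. 0 \<le> \<rho> x"
  shows "test_functions \<subseteq> potentials \<rho>"
proof
  fix \<phi> :: "real ^ 'd \<Rightarrow> real" assume \<phi>: "\<phi> \<in> test_functions"
  then have C1: "Ck_on 1 UNIV \<phi>" unfolding test_functions_def by simp
  obtain B where B: "\<And>x. norm (grad \<phi> x) \<le> B" using test_function_bounds[OF \<phi>] by blast
  have [measurable]: "grad \<phi> \<in> borel_measurable borel" "\<rho> \<in> borel_measurable borel"
    using C1_continuous_grad[OF C1] assms by (auto intro: borel_measurable_continuous_onI)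
  have "integrable lborel (\<lambda>x. (norm (grad \<phi> x))\<^sup>2 * \<rho> x)"
  proof (rule Bochner_Integration.integrable_bound[OF integrable_mult_right[OF assms(1), of "B\<^sup>2"]])
    show "AE x in lborel. norm ((norm (grad \<phi> x))\<^sup>2 * \<rho> x) \<le> norm (B\<^sup>2 * \<rho> x)"
      using assms(2) power_mono[OF B norm_ge_zero] by (simp add: abs_mult mult_right_mono)
  qed measurable
  with C1 show "\<phi> \<in> potentials \<rho>" unfolding potentials_def by simp
qed

lemma potentials_integrable_inner:
  assumes "integrable lborel \<rho>" "\<And>x. 0 \<le> \<rho> x" "\<psi> \<in> potentials \<rho>" "\<psi>' \<in> potentials \<rho>"
  shows "integrable lborel (\<lambda>x. (grad \<psi> x \<bullet> grad \<psi>' x) * \<rho> x)"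
  using assms borel_measurable_integrable[OF assms(1)]
  by (intro integrable_inner_mult_density) (auto simp: potentials_measurable_grad potentials_def)

text \<open>The energy of the sum expands into a double sum of weighted inner products of gradients,
  each integrable by the L^2(\<open>\<rho>\<close>) estimate.\<close>

lemma potentials_weighted_sum:
  fixes \<psi> :: "'k \<Rightarrow> real ^ 'd \<Rightarrow> real"
  assumes \<rho>: "integrable lborel \<rho>" "\<And>x. 0 \<le> \<rho> x"
    and \<psi>: "\<And>k. k \<in> I \<Longrightarrow> \<psi> k \<in> potentials \<rho>"
  shows "(\<lambda>x. \<Sum>k\<in>I. c k * \<psi> k x) \<in> potentials \<rho>"
proof -
  have C1: "\<And>k. k \<in> I \<Longrightarrow> Ck_on 1 UNIV (\<psi> k)" using \<psi> unfolding potentials_def by auto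
  have "integrable lborel (\<lambda>x. \<Sum>i\<in>I. \<Sum>j\<in>I. c i * (c j * ((grad (\<psi> i) x \<bullet> grad (\<psi> j) x) * \<rho> x)))"
    by (intro Bochner_Integration.integrable_sum integrable_mult_right potentials_integrable_inner \<rho> \<psi>)
  moreover have "(\<Sum>i\<in>I. \<Sum>j\<in>I. c i * (c j * ((grad (\<psi> i) x \<bullet> grad (\<psi> j) x) * \<rho> x)))
      = (norm (grad (\<lambda>x. \<Sum>k\<in>I. c k * \<psi> k x) x))\<^sup>2 * \<rho> x" for x
    by (simp add: C1_weighted_sum(2)[OF C1] power2_norm_eq_inner inner_sum_left inner_sum_right
        sum_distrib_left sum_distrib_right inner_commute mult_ac)
  ultimately show ?thesis
    using C1_weighted_sum(1)[OF C1] unfolding potentials_def by simp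
qed

lemma divergence_potential:
  "divergence (\<lambda>x. \<rho> x *\<^sub>R grad \<psi> x) \<phi> = - (\<integral>x. (grad \<psi> x \<bullet> grad \<phi> x) * \<rho> x \<partial>lborel)"
  by (simp add: divergence_def mult.commute)

lemma divergence_weighted_sum:
  fixes \<psi> :: "'k \<Rightarrow> real ^ 'd \<Rightarrow> real"
  assumes \<rho>: "integrable lborel \<rho>" "\<And>x. 0 \<le> \<rho> x"
    and \<psi>: "\<And>k. k \<in> I \<Longrightarrow> \<psi> k \<in> potentials \<rho>" and \<phi>: "\<phi> \<in> potentials \<rho>"
  shows "divergence (\<lambda>x. \<rho> x *\<^sub>R grad (\<lambda>x. \<Sum>k\<in>I. c k * \<psi> k x) x) \<phi> =
    (\<Sum>k\<in>I. c k * divergence (\<lambda>x. \<rho> x *\<^sub>R grad (\<psi> k) x) \<phi>)"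
proof -
  have C1: "\<And>k. k \<in> I \<Longrightarrow> Ck_on 1 UNIV (\<psi> k)" using \<psi> unfolding potentials_def by auto
  have "(\<integral>x. (\<Sum>k\<in>I. c k * ((grad (\<psi> k) x \<bullet> grad \<phi> x) * \<rho> x)) \<partial>lborel) =
      (\<Sum>k\<in>I. c k * (\<integral>x. (grad (\<psi> k) x \<bullet> grad \<phi> x) * \<rho> x \<partial>lborel))"
    by (subst Bochner_Integration.integral_sum)
       (auto intro!: integrable_mult_right potentials_integrable_inner \<rho> \<psi> \<phi>)
  then show ?thesis
    unfolding divergence_potential
    by (simp add: C1_weighted_sum(2)[OF C1] inner_sum_left sum_distrib_right
        mult.assoc sum_negf)
qed

text \<open>The difference of the two gradients is in L^2(\<open>\<rho>\<close>) and has vanishing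
  weighted divergence, so it is orthogonal to every potential gradient. This is the well-definedness
  of the Wasserstein metric.\<close>

lemma potentials_of_same_tangent:
  assumes \<rho>: "integrable lborel \<rho>" "\<And>x. 0 \<le> \<rho> x"
    and "is_potential_of \<rho> \<sigma> \<psi>" "is_potential_of \<rho> \<sigma> \<psi>'" and \<eta>: "\<eta> \<in> potentials \<rho>"
  shows "(\<integral>x. (grad \<psi> x \<bullet> grad \<eta> x) * \<rho> x \<partial>lborel) = (\<integral>x. (grad \<psi>' x \<bullet> grad \<eta> x) * \<rho> x \<partial>lborel)"
proof -
  have pot: "\<psi> \<in> potentials \<rho>" "\<psi>' \<in> potentials \<rho>"
    and eq: "\<And>\<phi>. \<phi> \<in> test_functions \<Longrightarrow> divergence (\<lambda>x. \<rho> x *\<^sub>R grad \<psi> x) \<phi>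
      = divergence (\<lambda>x. \<rho> x *\<^sub>R grad \<psi>' x) \<phi>"
    using assms unfolding is_potential_of_def by auto
  note int = potentials_integrable_inner[OF \<rho>]
  have [measurable]: "grad \<psi> \<in> borel_measurable borel" "grad \<psi>' \<in> borel_measurable borel"
      "\<rho> \<in> borel_measurable borel"
    using pot \<rho> by (auto intro: potentials_measurable_grad)
  have "(\<integral>x. ((grad \<psi> x - grad \<psi>' x) \<bullet> grad \<eta> x) * \<rho> x \<partial>lborel) = 0"
  proof (rule divergence_free_orthogonal_grad[OF \<rho> _ _ _ \<eta>])
    \<comment> \<open>The expanded square of the norm of the difference.\<close>
    have "integrable lborel (\<lambda>x. (grad \<psi> x \<bullet> grad \<psi> x) * \<rho> x - 2 * ((grad \<psi> x \<bullet> grad \<psi>' x) * \<rho> x)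
        + (grad \<psi>' x \<bullet> grad \<psi>' x) * \<rho> x)"
      by (intro Bochner_Integration.integrable_add Bochner_Integration.integrable_diff
          integrable_mult_right int pot)
    then show "integrable lborel (\<lambda>x. (norm (grad \<psi> x - grad \<psi>' x))\<^sup>2 * \<rho> x)"
      by (simp add: power2_norm_eq_inner inner_diff_left inner_diff_right inner_commute algebra_simps)
    fix \<phi> :: "real ^ 'a \<Rightarrow> real" assume \<phi>: "\<phi> \<in> test_functions"
    with test_functions_subset_potentials[OF \<rho>] have "\<phi> \<in> potentials \<rho>" by blast
    then have "(\<integral>x. (grad \<psi> x \<bullet> grad \<phi> x) * \<rho> x - (grad \<psi>' x \<bullet> grad \<phi> x) * \<rho> x \<partial>lborel) = 0"
      using eq[OF \<phi>] by (subst Bochner_Integration.integral_diff) (auto simp: divergence_potential int pot)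
    then show "divergence (\<lambda>x. \<rho> x *\<^sub>R (grad \<psi> x - grad \<psi>' x)) \<phi> = 0"
      by (simp add: divergence_def inner_diff_left algebra_simps)
  qed measurable
  then have "(\<integral>x. (grad \<psi> x \<bullet> grad \<eta> x) * \<rho> x - (grad \<psi>' x \<bullet> grad \<eta> x) * \<rho> x \<partial>lborel) = 0"
    by (simp add: inner_diff_left left_diff_distrib)
  then show ?thesis
    by (subst (asm) Bochner_Integration.integral_diff) (auto intro: int pot \<eta>)
qed

text \<open>Two arbitrary pairs of potentials give the same value: exchange the first potential,
  then, by symmetry of the inner product, the second. This justifies the definite description in
  \<open>wasserstein_metric\<close>.\<close>

lemma wasserstein_metric_eq:
  assumes \<rho>: "integrable lborel \<rho>" "\<And>x. 0 \<le> \<rho> x"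
    and \<psi>: "is_potential_of \<rho> \<sigma>1 \<psi>1" "is_potential_of \<rho> \<sigma>2 \<psi>2"
  shows "wasserstein_metric \<rho> \<sigma>1 \<sigma>2 = (\<integral>x. (grad \<psi>1 x \<bullet> grad \<psi>2 x) * \<rho> x \<partial>lborel)"
  unfolding wasserstein_metric_def
proof (rule the_equality)
  fix c
  assume "\<exists>\<psi>1 \<psi>2. is_potential_of \<rho> \<sigma>1 \<psi>1 \<and> is_potential_of \<rho> \<sigma>2 \<psi>2 \<and>
    c = (\<integral>x. (grad \<psi>1 x \<bullet> grad \<psi>2 x) * \<rho> x \<partial>lborel)"
  then obtain \<psi>1' \<psi>2' where \<psi>': "is_potential_of \<rho> \<sigma>1 \<psi>1'" "is_potential_of \<rho> \<sigma>2 \<psi>2'"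
    and c: "c = (\<integral>x. (grad \<psi>1' x \<bullet> grad \<psi>2' x) * \<rho> x \<partial>lborel)" by blast
  have pot: "\<psi>2' \<in> potentials \<rho>" "\<psi>1 \<in> potentials \<rho>"
    using \<psi> \<psi>' unfolding is_potential_of_def by auto
  have "c = (\<integral>x. (grad \<psi>1 x \<bullet> grad \<psi>2' x) * \<rho> x \<partial>lborel)"
    unfolding c by (rule potentials_of_same_tangent[OF \<rho> \<psi>'(1) \<psi>(1) pot(1)])
  also have "\<dots> = (\<integral>x. (grad \<psi>1 x \<bullet> grad \<psi>2 x) * \<rho> x \<partial>lborel)"
    using potentials_of_same_tangent[OF \<rho> \<psi>'(2) \<psi>(2) pot(2)] by (simp add: inner_commute)
  finally show "c = (\<integral>x. (grad \<psi>1 x \<bullet> grad \<psi>2 x) * \<rho> x \<partial>lborel)" .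
qed (use \<psi> in blast)

subsection \<open>Families of bijections\<close>

locale C1_bijection_family =
  fixes \<Theta> :: "'a::euclidean_space set" and T :: "'a \<Rightarrow> real ^ 'd \<Rightarrow> real ^ 'd"
  assumes open_domain: "open \<Theta>"
    and bij_T: "\<And>\<theta>. \<theta> \<in> \<Theta> \<Longrightarrow> bij (T \<theta>)"
    and C1_T: "Ck_on 1 (\<Theta> \<times> UNIV) (\<lambda>(\<theta>, x). T \<theta> x)"
begin

text \<open>The derivative in the parameter direction \<open>\<xi>\<close> is taken from the joint
  derivative, which makes it linear in \<open>\<xi>\<close> and jointly continuous in the remaining
  arguments.\<close>

definition dT :: "'a \<Rightarrow> 'a \<Rightarrow> real ^ 'd \<Rightarrow> real ^ 'd" where
  "dT \<xi> \<theta> y = frechet_derivative (\<lambda>(\<theta>, x). T \<theta> x) (at (\<theta>, y)) (\<xi>, 0)"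

lemma has_derivative_T:
  assumes "\<theta> \<in> \<Theta>"
  shows "((\<lambda>(\<theta>, x). T \<theta> x) has_derivative frechet_derivative (\<lambda>(\<theta>, x). T \<theta> x) (at (\<theta>, y))) (at (\<theta>, y))"
  using C1_T assms by (simp add: frechet_derivative_works[symmetric])

lemma has_vector_derivative_T_line:
  assumes "\<theta> + s *\<^sub>R \<xi> \<in> \<Theta>"
  shows "((\<lambda>s. T (\<theta> + s *\<^sub>R \<xi>) y) has_vector_derivative dT \<xi> (\<theta> + s *\<^sub>R \<xi>) y) (at s)"
proof -
  let ?D = "frechet_derivative (\<lambda>(\<theta>, x). T \<theta> x) (at (\<theta> + s *\<^sub>R \<xi>, y))"
  note D = has_derivative_T[OF assms, of y]
  have "((\<lambda>s. (\<theta> + s *\<^sub>R \<xi>, y)) has_derivative (\<lambda>h. (h *\<^sub>R \<xi>, 0))) (at s)"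
    by (auto intro!: derivative_eq_intros)
  from has_derivative_compose[OF this D]
  have "((\<lambda>s. T (\<theta> + s *\<^sub>R \<xi>) y) has_derivative (\<lambda>h. ?D (h *\<^sub>R \<xi>, 0))) (at s)"
    by simp
  moreover have "?D (h *\<^sub>R \<xi>, 0) = h *\<^sub>R dT \<xi> (\<theta> + s *\<^sub>R \<xi>) y" for h
    using linear_scale[OF has_derivative_linear[OF D], of h "(\<xi>, 0)"] by (simp add: dT_def)
  ultimately show ?thesis by (simp add: has_vector_derivative_def)
qed

lemma dT_weighted_sum:
  assumes "\<theta> \<in> \<Theta>"
  shows "dT (\<Sum>k\<in>I. c k *\<^sub>R v k) \<theta> y = (\<Sum>k\<in>I. c k *\<^sub>R dT (v k) \<theta> y)"
proof -
  note l = has_derivative_linear[OF has_derivative_T[OF assms, of y]]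
  have "(\<Sum>k\<in>I. c k *\<^sub>R v k, 0) = (\<Sum>k\<in>I. c k *\<^sub>R (v k, 0 :: real ^ 'd))"
    by (intro prod_eqI) (simp_all add: fst_sum snd_sum)
  then show ?thesis
    by (simp add: dT_def linear_sum[OF l] linear_scale[OF l] del: scaleR_Pair)
qed

lemma continuous_on_T: "continuous_on (\<Theta> \<times> UNIV) (\<lambda>(\<theta>, y). T \<theta> y)"
  using has_derivative_T
  by (force simp: continuous_on_eq_continuous_at open_Times open_domain intro!: has_derivative_continuous)

lemma continuous_on_dT: "continuous_on (\<Theta> \<times> UNIV) (\<lambda>(\<theta>, y). dT \<xi> \<theta> y)"
proof -
  have "continuous_on (\<Theta> \<times> UNIV) (\<lambda>z. frechet_derivative (\<lambda>(\<theta>, x). T \<theta> x) (at z) (\<xi>, 0))"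
    using C1_T by simp
  then show ?thesis by (simp add: dT_def split_def)
qed

lemma continuous_slice:
  assumes "continuous_on (\<Theta> \<times> UNIV) (\<lambda>(\<theta>, y). f \<theta> y)" "\<theta> \<in> \<Theta>"
  shows "continuous_on (UNIV :: (real ^ 'd) set) (f \<theta>)"
proof -
  have "continuous_on UNIV ((\<lambda>(\<theta>, y). f \<theta> y) \<circ> Pair \<theta>)"
    by (rule continuous_on_compose) (use assms in \<open>auto intro!: continuous_intros elim!: continuous_on_subset\<close>)
  then show ?thesis by (simp add: o_def)
qed

text \<open>Invariance of domain: a continuous injection between spaces of equal dimension has a
  continuous inverse on its image. It is used for the measurability of fields transported by
  \<open>inv (T \<theta>)\<close>.\<close>

lemma continuous_on_inv_T:
  assumes "\<theta> \<in> \<Theta>"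
  shows "continuous_on UNIV (inv (T \<theta>))"
proof -
  have "continuous_on (T \<theta> ` UNIV) (inv (T \<theta>))"
    by (rule continuous_on_inverse_open[where f="T \<theta>"])
       (use bij_T[OF assms] continuous_slice[OF continuous_on_T assms] in \<open>auto simp: bij_def inv_f_f\<close>)
  with bij_T[OF assms] show ?thesis by (simp add: bij_def)
qed

text \<open>
  The inverse maps are jointly continuous by invariance of domain, so preimages of a compact set
  stay in a compact set locally uniformly in the parameter.
\<close>

lemma compact_preimage:
  assumes "compact K" "K \<subseteq> \<Theta>" "compact L"
  shows "compact {(\<theta>, y). \<theta> \<in> K \<and> T \<theta> y \<in> L}"
proof -
  \<comment> \<open>Carrying the parameter along makes the whole family a single injective map of an
    open set onto itself, to which invariance of domain applies.\<close>
  define P where "P = (\<lambda>(\<theta>, y). (\<theta>, T \<theta> y))"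
  have P: "continuous_on (\<Theta> \<times> UNIV) P"
    using continuous_on_T unfolding P_def split_def by (intro continuous_intros)
  have inj: "inj_on P (\<Theta> \<times> UNIV)"
    by (auto simp: P_def intro!: inj_onI dest: bij_is_inj[OF bij_T, THEN injD])
  have T_inv: "T \<theta> (inv (T \<theta>) z) = z" if "\<theta> \<in> \<Theta>" for \<theta> z
    using bij_is_surj[OF bij_T[OF that]] by (rule surj_f_inv_f)
  have im: "P ` (\<Theta> \<times> UNIV) = \<Theta> \<times> UNIV"
  proof -
    have "(\<theta>, z) \<in> P ` (\<Theta> \<times> UNIV)" if "\<theta> \<in> \<Theta>" for \<theta> z
      using that by (intro image_eqI[where x="(\<theta>, inv (T \<theta>) z)"]) (auto simp: P_def T_inv)
    then show ?thesis by (auto simp: P_def)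
  qed
  obtain g where g: "homeomorphism (\<Theta> \<times> UNIV) (\<Theta> \<times> UNIV) P g"
    using invariance_of_domain_homeomorphism[OF open_Times[OF open_domain open_UNIV] P _ inj] im by auto
  then have "compact (g ` (K \<times> L))"
    using assms by (intro compact_continuous_image compact_Times)
      (auto simp: homeomorphism_def elim!: continuous_on_subset)
  \<comment> \<open>The inverse homeomorphism acts as \<open>inv (T \<theta>)\<close> on each fibre,
    so the set in question is a continuous image of \<open>K \<times> L\<close>.\<close>
  moreover have "g ` (K \<times> L) = {(\<theta>, y). \<theta> \<in> K \<and> T \<theta> y \<in> L}"
  proof -
    have gP: "g (\<theta>, T \<theta> y) = (\<theta>, y)" if "\<theta> \<in> \<Theta>" for \<theta> y
      using g that by (auto simp: homeomorphism_def P_def)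
    have "g (\<theta>, z) = (\<theta>, inv (T \<theta>) z)" if "\<theta> \<in> \<Theta>" for \<theta> z
      using gP[OF that, of "inv (T \<theta>) z"] by (simp add: T_inv that)
    then have "g ` (K \<times> L) \<subseteq> {(\<theta>, y). \<theta> \<in> K \<and> T \<theta> y \<in> L}"
      using assms(2) by (auto simp: T_inv subset_iff)
    moreover have "(\<theta>, y) \<in> g ` (K \<times> L)" if "\<theta> \<in> K" "T \<theta> y \<in> L" for \<theta> y
      using that assms(2) gP[of \<theta> y] by (intro image_eqI[where x="(\<theta>, T \<theta> y)"]) auto
    ultimately show ?thesis by auto
  qed
  ultimately show ?thesis by simp
qed

section \<open>Differentiation under the integral sign\<close>

text \<open>The expression vanishes unless \<open>T (\<theta> + s *\<^sub>R \<xi>) y\<close> lies in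
  the support of \<open>\<phi>\<close>. For parameters in a closed ball such pairs form a compact
  set, on which a continuous function is bounded. The bound is uniform in \<open>s\<close> and
  \<open>y\<close> and supplies the dominating constant.\<close>

lemma chain_rule_bounded:
  assumes \<theta>: "\<theta> \<in> \<Theta>" and \<phi>: "\<phi> \<in> test_functions"
  obtains r B where "r > 0" "\<And>s. \<bar>s\<bar> \<le> r \<Longrightarrow> \<theta> + s *\<^sub>R \<xi> \<in> \<Theta>"
    "\<And>s y. \<bar>s\<bar> \<le> r \<Longrightarrow> \<bar>grad \<phi> (T (\<theta> + s *\<^sub>R \<xi>) y) \<bullet> dT \<xi> (\<theta> + s *\<^sub>R \<xi>) y\<bar> \<le> B"
proof -
  let ?K = "closure (support_on UNIV \<phi>)"
  let ?h = "\<lambda>(\<theta>, y). grad \<phi> (T \<theta> y) \<bullet> dT \<xi> \<theta> y"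
  have C1: "Ck_on 1 UNIV \<phi>" and K: "compact ?K"
    using \<phi> unfolding test_functions_def by auto
  obtain \<delta> where \<delta>: "\<delta> > 0" "cball \<theta> \<delta> \<subseteq> \<Theta>"
    using open_domain \<theta> open_contains_cball by blast
  let ?C = "{(\<theta>', y). \<theta>' \<in> cball \<theta> \<delta> \<and> T \<theta>' y \<in> ?K}"
  have "compact ?C" by (rule compact_preimage[OF _ \<delta>(2) K]) simp
  moreover have "continuous_on (\<Theta> \<times> UNIV) ?h"
    using continuous_on_T continuous_on_dT continuous_on_compose2[OF C1_continuous_grad[OF C1]]
    unfolding split_def by (intro continuous_intros) auto
  then have "continuous_on ?C ?h" by (rule continuous_on_subset) (use \<delta> in auto)
  ultimately have "bounded (?h ` ?C)"
    by (intro compact_imp_bounded compact_continuous_image)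
  then obtain B where B: "B > 0" and "\<forall>w \<in> ?h ` ?C. norm w \<le> B"
    unfolding bounded_pos by blast
  then have hB: "norm (?h z) \<le> B" if "z \<in> ?C" for z
    using that by blast
  \<comment> \<open>The added 1 covers \<open>\<xi> = 0\<close> and keeps the segment inside the
    ball of radius \<open>\<delta>\<close>.\<close>
  define r where "r = \<delta> / (norm \<xi> + 1)"
  have r: "r > 0" using \<delta> by (simp add: r_def add_nonneg_pos)
  have near: "\<theta> + s *\<^sub>R \<xi> \<in> cball \<theta> \<delta>" if "\<bar>s\<bar> \<le> r" for s
  proof -
    have "\<bar>s\<bar> * norm \<xi> \<le> r * (norm \<xi> + 1)" using that r by (intro mult_mono) auto
    also have "\<dots> = \<delta>" by (simp add: r_def add_nonneg_eq_0_iff)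
    finally show ?thesis by (simp add: dist_norm)
  qed
  show thesis
  proof (rule that[OF r])
    show "\<theta> + s *\<^sub>R \<xi> \<in> \<Theta>" if "\<bar>s\<bar> \<le> r" for s using near[OF that] \<delta> by blast
    show "\<bar>grad \<phi> (T (\<theta> + s *\<^sub>R \<xi>) y) \<bullet> dT \<xi> (\<theta> + s *\<^sub>R \<xi>) y\<bar> \<le> B" if "\<bar>s\<bar> \<le> r" for s y
    proof (cases "T (\<theta> + s *\<^sub>R \<xi>) y \<in> ?K")
      case True
      then show ?thesis using hB[of "(\<theta> + s *\<^sub>R \<xi>, y)"] near[OF that] by auto
    next
      case False
      then show ?thesis using B by (simp add: grad_outside_support)
    qed
  qed
qed

text \<open>Difference quotients are bounded by the constant of \<open>chain_rule_bounded\<close>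
  through the mean value inequality. A constant is integrable for a finite measure, so dominated
  convergence applies.\<close>

lemma DERIV_integral_compose_T:
  assumes "finite_measure M" and [measurable_cong]: "sets M = sets borel"
    and \<theta>: "\<theta> \<in> \<Theta>" and \<phi>: "\<phi> \<in> test_functions"
  shows "((\<lambda>s. \<integral>y. \<phi> (T (\<theta> + s *\<^sub>R \<xi>) y) \<partial>M) has_real_derivative
    (\<integral>y. grad \<phi> (T \<theta> y) \<bullet> dT \<xi> \<theta> y \<partial>M)) (at 0)"
proof -
  interpret finite_measure M by fact
  have C1: "Ck_on 1 UNIV \<phi>" using \<phi> unfolding test_functions_def by auto
  obtain r B where r: "r > 0" and dom: "\<And>s. \<bar>s\<bar> \<le> r \<Longrightarrow> \<theta> + s *\<^sub>R \<xi> \<in> \<Theta>"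
    and B: "\<And>s y. \<bar>s\<bar> \<le> r \<Longrightarrow> \<bar>grad \<phi> (T (\<theta> + s *\<^sub>R \<xi>) y) \<bullet> dT \<xi> (\<theta> + s *\<^sub>R \<xi>) y\<bar> \<le> B"
    by (rule chain_rule_bounded[OF \<theta> \<phi>]) (rule that)
  obtain A where A: "\<And>x. \<bar>\<phi> x\<bar> \<le> A" "\<And>x. norm (grad \<phi> x) \<le> A"
    by (rule test_function_bounds[OF \<phi>]) (rule that)
  let ?f = "\<lambda>s y. \<phi> (T (\<theta> + s *\<^sub>R \<xi>) y)"
  have meas[measurable]: "?f s \<in> borel_measurable M" if "\<bar>s\<bar> \<le> r" for s
  proof -
    have "continuous_on UNIV (?f s)"
      using continuous_on_compose2[OF C1_continuous[OF C1] continuous_slice[OF continuous_on_T dom[OF that]]] by simp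
    from borel_measurable_continuous_onI[OF this] show ?thesis by measurable
  qed
  have int: "integrable M (?f s)" if "\<bar>s\<bar> \<le> r" for s
    by (rule integrable_const_bound[where B=A]) (use A(1) meas[OF that] in auto)
  have der: "((\<lambda>s. ?f s y) has_real_derivative grad \<phi> (T (\<theta> + s *\<^sub>R \<xi>) y) \<bullet> dT \<xi> (\<theta> + s *\<^sub>R \<xi>) y) (at s)"
    if "\<bar>s\<bar> \<le> r" for s y
    using has_derivative_compose[OF has_vector_derivative_T_line[OF dom[OF that], unfolded has_vector_derivative_def]
        C1_has_derivative_grad[OF C1], of y]
    by (simp add: has_field_derivative_def mult.commute[of _ "grad \<phi> _ \<bullet> _"])
  have lip: "\<bar>?f s y - ?f 0 y\<bar> \<le> B * \<bar>s\<bar>" if "\<bar>s\<bar> \<le> r" for s y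
    using field_differentiable_bound[of "cball 0 r" "\<lambda>s. ?f s y"
        "\<lambda>s. grad \<phi> (T (\<theta> + s *\<^sub>R \<xi>) y) \<bullet> dT \<xi> (\<theta> + s *\<^sub>R \<xi>) y" B s 0] that r
    by (auto intro!: DERIV_subset[OF der] B)
  \<comment> \<open>Working within \<open>cball 0 r\<close> keeps every term of an approaching
    sequence in the range of the uniform bound. As 0 is an interior point, the restriction
    disappears at the end.\<close>
  have "((\<lambda>s. ((\<integral>y. ?f s y \<partial>M) - (\<integral>y. ?f 0 y \<partial>M)) / (s - 0)) \<longlongrightarrow>
      (\<integral>y. grad \<phi> (T \<theta> y) \<bullet> dT \<xi> \<theta> y \<partial>M)) (at 0 within cball 0 r)"
    unfolding tendsto_at_iff_sequentially o_def
  proof (intro allI impI)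
    fix X :: "nat \<Rightarrow> real"
    assume X: "\<forall>i. X i \<in> cball 0 r - {0}" "X \<longlonglongrightarrow> 0"
    then have Xr: "\<bar>X n\<bar> \<le> r" "X n \<noteq> 0" for n by auto
    have "(\<lambda>n. \<integral>y. (?f (X n) y - ?f 0 y) / X n \<partial>M) \<longlonglongrightarrow> (\<integral>y. grad \<phi> (T \<theta> y) \<bullet> dT \<xi> \<theta> y \<partial>M)"
    proof (rule integral_dominated_convergence)
      show "integrable M (\<lambda>_. B)" by simp
      show "AE y in M. norm ((?f (X n) y - ?f 0 y) / X n) \<le> B" for n
        using lip[OF Xr(1)] Xr(2)[of n] by (simp add: divide_le_eq)
      show "AE y in M. (\<lambda>n. (?f (X n) y - ?f 0 y) / X n) \<longlonglongrightarrow> grad \<phi> (T \<theta> y) \<bullet> dT \<xi> \<theta> y"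
      proof (rule AE_I2)
        fix y
        have "((\<lambda>s. (?f s y - ?f 0 y) / (s - 0)) \<longlongrightarrow> grad \<phi> (T \<theta> y) \<bullet> dT \<xi> \<theta> y) (at 0)"
          using der[of 0 y] r by (simp add: has_field_derivative_iff)
        then show "(\<lambda>n. (?f (X n) y - ?f 0 y) / X n) \<longlonglongrightarrow> grad \<phi> (T \<theta> y) \<bullet> dT \<xi> \<theta> y"
          using X Xr(2) by (auto simp: tendsto_at_iff_sequentially o_def)
      qed
      show "(\<lambda>y. (?f (X n) y - ?f 0 y) / X n) \<in> borel_measurable M" for n
        using meas[OF Xr(1)] meas[of 0] r by simp
      show "(\<lambda>y. grad \<phi> (T \<theta> y) \<bullet> dT \<xi> \<theta> y) \<in> borel_measurable M"
        using continuous_on_compose2[OF C1_continuous_grad[OF C1] continuous_slice[OF continuous_on_T \<theta>]]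
          continuous_slice[OF continuous_on_dT \<theta>, of \<xi>]
        by (auto simp: measurable_cong_sets[OF assms(2) refl]
            intro!: borel_measurable_continuous_onI continuous_intros)
    qed
    then show "(\<lambda>n. ((\<integral>y. ?f (X n) y \<partial>M) - (\<integral>y. ?f 0 y \<partial>M)) / (X n - 0)) \<longlonglongrightarrow>
        (\<integral>y. grad \<phi> (T \<theta> y) \<bullet> dT \<xi> \<theta> y \<partial>M)"
      using int[OF Xr(1)] int[of 0] r by simp
  qed
  then have "((\<lambda>s. \<integral>y. ?f s y \<partial>M) has_real_derivative (\<integral>y. grad \<phi> (T \<theta> y) \<bullet> dT \<xi> \<theta> y \<partial>M)) (at 0 within cball 0 r)"
    by (simp add: has_field_derivative_iff)
  then show ?thesis
    using at_within_interior[of "0 :: real" "cball 0 r"] r by (simp add: interior_cball)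
qed

text \<open>Linearity comes from \<open>dT_weighted_sum\<close>; the integrability needed to
  exchange sum and integral comes from the uniform bound at \<open>s = 0\<close>.\<close>

lemma integral_chain_rule_weighted_sum:
  assumes "finite_measure M" and sets: "sets M = sets borel"
    and \<theta>: "\<theta> \<in> \<Theta>" and \<phi>: "\<phi> \<in> test_functions"
  shows "(\<integral>y. grad \<phi> (T \<theta> y) \<bullet> dT (\<Sum>k\<in>I. c k *\<^sub>R v k) \<theta> y \<partial>M) =
    (\<Sum>k\<in>I. c k * (\<integral>y. grad \<phi> (T \<theta> y) \<bullet> dT (v k) \<theta> y \<partial>M))"
proof -
  interpret finite_measure M by fact
  have C1: "Ck_on 1 UNIV \<phi>" using \<phi> unfolding test_functions_def by auto
  have "integrable M (\<lambda>y. grad \<phi> (T \<theta> y) \<bullet> dT \<xi> \<theta> y)" for \<xi>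
  proof -
    obtain r B where "r > 0" "\<And>s. \<bar>s\<bar> \<le> r \<Longrightarrow> \<theta> + s *\<^sub>R \<xi> \<in> \<Theta>" and hB:
      "\<And>s y. \<bar>s\<bar> \<le> r \<Longrightarrow> \<bar>grad \<phi> (T (\<theta> + s *\<^sub>R \<xi>) y) \<bullet> dT \<xi> (\<theta> + s *\<^sub>R \<xi>) y\<bar> \<le> B"
      by (rule chain_rule_bounded[OF \<theta> \<phi>]) (rule that)
    then have B: "\<bar>grad \<phi> (T \<theta> y) \<bullet> dT \<xi> \<theta> y\<bar> \<le> B" for y using hB[of 0 y] by simp
    have "(\<lambda>y. grad \<phi> (T \<theta> y) \<bullet> dT \<xi> \<theta> y) \<in> borel_measurable M"
      using continuous_on_compose2[OF C1_continuous_grad[OF C1] continuous_slice[OF continuous_on_T \<theta>]]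
        continuous_slice[OF continuous_on_dT \<theta>, of \<xi>]
      by (auto simp: measurable_cong_sets[OF sets refl]
          intro!: borel_measurable_continuous_onI continuous_intros)
    with B show ?thesis by (intro integrable_const_bound[where B=B]) auto
  qed
  then show ?thesis
    by (simp add: dT_weighted_sum[OF \<theta>] inner_sum_right)
qed

end

subsection \<open>Pushforward tangent vectors\<close>

locale pushforward_family = C1_bijection_family \<Theta> T
  for \<Theta> :: "(real ^ 'm) set" and T :: "real ^ 'm \<Rightarrow> real ^ 'd \<Rightarrow> real ^ 'd" +
  fixes M :: "(real ^ 'd) measure" and \<rho> :: "real ^ 'm \<Rightarrow> real ^ 'd \<Rightarrow> real"
  assumes finite_M: "finite_measure M" and sets_M: "sets M = sets borel"
    and distributed_T: "\<And>\<theta>. \<theta> \<in> \<Theta> \<Longrightarrow> distributed M lborel (T \<theta>) (\<rho> \<theta>)"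
    and densities_\<rho>: "\<And>\<theta>. \<theta> \<in> \<Theta> \<Longrightarrow> \<rho> \<theta> \<in> densities"
begin

lemma integrable_\<rho>: "\<theta> \<in> \<Theta> \<Longrightarrow> integrable lborel (\<rho> \<theta>)"
  and nonneg_\<rho>: "\<theta> \<in> \<Theta> \<Longrightarrow> 0 \<le> \<rho> \<theta> x"
  using densities_\<rho> by (auto simp: densities_def has_bochner_integral_iff)

lemma integral_change_of_variables:
  assumes "\<theta> \<in> \<Theta>" "g \<in> borel_measurable borel"
  shows "(\<integral>x. g x * \<rho> \<theta> x \<partial>lborel) = (\<integral>y. g (T \<theta> y) \<partial>M)"
    and "integrable lborel (\<lambda>x. g x * \<rho> \<theta> x) \<longleftrightarrow> integrable M (\<lambda>y. g (T \<theta> y))"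
  using distributed_integral[OF distributed_T[OF assms(1)], of g]
    distributed_integrable[OF distributed_T[OF assms(1)], of g] assms nonneg_\<rho>
  by (simp_all add: mult.commute)

text \<open>Among the admissible curves is the straight line through \<open>\<theta>\<close> with
  direction \<open>\<xi>\<close>. Near 0, change of variables turns the integral against the density
  into one of \<open>\<phi>\<close> composed with \<open>T\<close>. The same function thus has both
  sides as its derivative at 0.\<close>

lemma integral_pushforward_tangent:
  assumes \<theta>: "\<theta> \<in> \<Theta>" and \<sigma>: "is_pushforward_tangent \<Theta> \<rho> \<theta> \<xi> \<sigma>" and \<phi>: "\<phi> \<in> test_functions"
  shows "(\<integral>x. \<sigma> x * \<phi> x \<partial>lborel) = (\<integral>y. grad \<phi> (T \<theta> y) \<bullet> dT \<xi> \<theta> y \<partial>M)"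
proof -
  have C1: "Ck_on 1 UNIV \<phi>" using \<phi> unfolding test_functions_def by auto
  obtain r B where r: "r > 0" and dom: "\<And>s. \<bar>s\<bar> \<le> r \<Longrightarrow> \<theta> + s *\<^sub>R \<xi> \<in> \<Theta>"
    and "\<And>s y. \<bar>s\<bar> \<le> r \<Longrightarrow> \<bar>grad \<phi> (T (\<theta> + s *\<^sub>R \<xi>) y) \<bullet> dT \<xi> (\<theta> + s *\<^sub>R \<xi>) y\<bar> \<le> B"
    by (rule chain_rule_bounded[OF \<theta> \<phi>]) (rule that)
  define \<gamma> where "\<gamma> = (\<lambda>s::real. \<theta> + s *\<^sub>R \<xi>)"
  have \<gamma>': "(\<gamma> has_vector_derivative \<xi>) (at s)" for s
    unfolding \<gamma>_def by (auto intro!: derivative_eq_intros)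
  then have "\<gamma> differentiable_on {-r<..<r}"
    by (meson differentiableI differentiable_at_imp_differentiable_on has_vector_derivative_def)
  moreover have "\<gamma> ` {-r<..<r} \<subseteq> \<Theta>" using dom by (auto simp: \<gamma>_def)
  ultimately have "has_velocity (\<lambda>t. \<rho> (\<gamma> t)) \<sigma>"
    using \<sigma> r \<gamma>' unfolding is_pushforward_tangent_def by (auto simp: \<gamma>_def)
  then have "((\<lambda>t. \<integral>x. \<rho> (\<gamma> t) x * \<phi> x \<partial>lborel) has_real_derivative (\<integral>x. \<sigma> x * \<phi> x \<partial>lborel)) (at 0)"
    using \<phi> unfolding has_velocity_def by blast
  moreover have "((\<lambda>t. \<integral>x. \<rho> (\<gamma> t) x * \<phi> x \<partial>lborel) has_real_derivative
      (\<integral>y. grad \<phi> (T \<theta> y) \<bullet> dT \<xi> \<theta> y \<partial>M)) (at 0)"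
  proof (rule has_field_derivative_transform_within_open)
    show "((\<lambda>s. \<integral>y. \<phi> (T (\<theta> + s *\<^sub>R \<xi>) y) \<partial>M) has_real_derivative
        (\<integral>y. grad \<phi> (T \<theta> y) \<bullet> dT \<xi> \<theta> y \<partial>M)) (at 0)"
      by (rule DERIV_integral_compose_T[OF finite_M sets_M \<theta> \<phi>])
    show "(\<integral>y. \<phi> (T (\<theta> + s *\<^sub>R \<xi>) y) \<partial>M) = (\<integral>x. \<rho> (\<gamma> s) x * \<phi> x \<partial>lborel)" if "s \<in> {-r<..<r}" for s
    proof -
      have "\<theta> + s *\<^sub>R \<xi> \<in> \<Theta>" using that by (intro dom) auto
      from integral_change_of_variables(1)[OF this borel_measurable_continuous_onI[OF C1_continuous[OF C1]]]
      show ?thesis by (simp add: \<gamma>_def mult.commute)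
    qed
  qed (use r in auto)
  ultimately show ?thesis by (rule DERIV_unique)
qed

lemma param_deriv_eq: "\<theta> \<in> \<Theta> \<Longrightarrow> param_deriv T k \<theta> y = dT (axis k 1) \<theta> y"
  using has_vector_derivative_T_line[of \<theta> 0 "axis k 1" y]
  by (simp add: param_deriv_def vector_derivative_at)

text \<open>Substituting \<open>x = T \<theta> y\<close> cancels \<open>inv (T \<theta>)\<close>.
  What remains is, up to sign, the weak form of the tangent vector along the \<open>k\<close>-th
  axis.\<close>

lemma divergence_param_deriv:
  assumes \<theta>: "\<theta> \<in> \<Theta>" and \<phi>: "\<phi> \<in> test_functions"
  shows "divergence (\<lambda>x. \<rho> \<theta> x *\<^sub>R param_deriv T k \<theta> (inv (T \<theta>) x)) \<phi> =
    - (\<integral>y. grad \<phi> (T \<theta> y) \<bullet> dT (axis k 1) \<theta> y \<partial>M)"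
proof -
  have C1: "Ck_on 1 UNIV \<phi>" using \<phi> unfolding test_functions_def by auto
  let ?g = "\<lambda>x. grad \<phi> x \<bullet> dT (axis k 1) \<theta> (inv (T \<theta>) x)"
  have "continuous_on UNIV ?g"
    by (intro continuous_intros C1_continuous_grad[OF C1]
        continuous_on_compose2[OF continuous_slice[OF continuous_on_dT \<theta>] continuous_on_inv_T[OF \<theta>]]) auto
  then have "?g \<in> borel_measurable borel" by (rule borel_measurable_continuous_onI)
  from integral_change_of_variables(1)[OF \<theta> this] show ?thesis
    using bij_is_inj[OF bij_T[OF \<theta>]]
    by (simp add: divergence_def param_deriv_eq[OF \<theta>] inner_commute mult.commute inv_f_f)
qed

text \<open>The tangent vector along an axis is minus the divergence on the right of the potential
  equation, and a potential represents it as minus a weighted divergence; the signs cancel.\<close>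

lemma is_potential_of_axis_iff:
  assumes "\<theta> \<in> \<Theta>" "is_pushforward_tangent \<Theta> \<rho> \<theta> (axis k 1) \<sigma>"
  shows "is_potential_of (\<rho> \<theta>) \<sigma> \<psi> \<longleftrightarrow> solves_potential_equation T (\<rho> \<theta>) \<theta> k \<psi>"
  unfolding is_potential_of_def solves_potential_equation_def
  using integral_pushforward_tangent[OF assms] divergence_param_deriv[OF assms(1), of _ k] by auto

text \<open>Expanding \<open>\<xi>\<close> in the standard basis reduces its weak tangent equation
  to the equations for the single \<open>\<psi> k\<close>; both sides depend linearly on the
  coefficients.\<close>

lemma is_potential_of_weighted_sum:
  assumes \<theta>: "\<theta> \<in> \<Theta>" and \<sigma>: "is_pushforward_tangent \<Theta> \<rho> \<theta> \<xi> \<sigma>"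
    and \<psi>: "\<And>k. solves_potential_equation T (\<rho> \<theta>) \<theta> k (\<psi> k)"
  shows "is_potential_of (\<rho> \<theta>) \<sigma> (\<lambda>x. \<Sum>k\<in>UNIV. \<xi> $ k * \<psi> k x)"
proof -
  note \<rho> = integrable_\<rho>[OF \<theta>] nonneg_\<rho>[OF \<theta>]
  have pot: "\<And>k. \<psi> k \<in> potentials (\<rho> \<theta>)"
    using \<psi> unfolding solves_potential_equation_def by blast
  have "(\<integral>x. \<sigma> x * \<phi> x \<partial>lborel) =
      - divergence (\<lambda>x. \<rho> \<theta> x *\<^sub>R grad (\<lambda>x. \<Sum>k\<in>UNIV. \<xi> $ k * \<psi> k x) x) \<phi>"
    if \<phi>: "\<phi> \<in> test_functions" for \<phi>
  proof -
    have \<phi>': "\<phi> \<in> potentials (\<rho> \<theta>)" using test_functions_subset_potentials[OF \<rho>] \<phi> by blast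
    have "(\<integral>x. \<sigma> x * \<phi> x \<partial>lborel) =
        (\<integral>y. grad \<phi> (T \<theta> y) \<bullet> dT (\<Sum>k\<in>UNIV. \<xi> $ k *\<^sub>R axis k 1) \<theta> y \<partial>M)"
      using integral_pushforward_tangent[OF \<theta> \<sigma> \<phi>]
      by (simp add: basis_expansion flip: scalar_mult_eq_scaleR)
    also have "\<dots> = (\<Sum>k\<in>UNIV. \<xi> $ k * (\<integral>y. grad \<phi> (T \<theta> y) \<bullet> dT (axis k 1) \<theta> y \<partial>M))"
      by (rule integral_chain_rule_weighted_sum[OF finite_M sets_M \<theta> \<phi>])
    also have "\<dots> = - (\<Sum>k\<in>UNIV. \<xi> $ k * divergence (\<lambda>x. \<rho> \<theta> x *\<^sub>R grad (\<psi> k) x) \<phi>)"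
      using \<psi> \<phi> divergence_param_deriv[OF \<theta> \<phi>]
      by (simp add: solves_potential_equation_def sum_negf)
    also have "\<dots> = - divergence (\<lambda>x. \<rho> \<theta> x *\<^sub>R grad (\<lambda>x. \<Sum>k\<in>UNIV. \<xi> $ k * \<psi> k x) x) \<phi>"
      by (simp only: divergence_weighted_sum[where \<psi>=\<psi>, OF \<rho> pot \<phi>'])
    finally show ?thesis .
  qed
  then show ?thesis
    unfolding is_potential_of_def using potentials_weighted_sum[where \<psi>=\<psi>, OF \<rho> pot] by blast
qed

text \<open>Existence comes from the immersion rather than from elliptic theory: it provides a
  potential of each tangent vector along an axis.\<close>

lemma ex_solves_potential_equation:
  assumes "wasserstein_immersion \<Theta> \<rho>" "\<theta> \<in> \<Theta>"
  shows "\<exists>\<psi>. solves_potential_equation T (\<rho> \<theta>) \<theta> k \<psi>"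
  using assms is_potential_of_axis_iff[OF assms(2)] unfolding wasserstein_immersion_def by metis

section \<open>The pullback as a Gram matrix\<close>

text \<open>Whichever tangent vector the choice operator selects, the weighted sum of the
  \<open>\<psi> k\<close> is a potential of it, so the value is independent of the
  selection.\<close>

lemma pullback_metric_eq:
  assumes imm: "wasserstein_immersion \<Theta> \<rho>" and \<theta>: "\<theta> \<in> \<Theta>"
    and \<psi>: "\<And>k. solves_potential_equation T (\<rho> \<theta>) \<theta> k (\<psi> k)"
  shows "pullback_metric \<Theta> \<rho> \<theta> \<xi> \<eta> = (\<integral>x. (grad (\<lambda>x. \<Sum>k\<in>UNIV. \<xi> $ k * \<psi> k x) x \<bullet>
      grad (\<lambda>x. \<Sum>k\<in>UNIV. \<eta> $ k * \<psi> k x) x) * \<rho> \<theta> x \<partial>lborel)"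
proof -
  have "is_pushforward_tangent \<Theta> \<rho> \<theta> \<zeta> (pushforward_tangent \<Theta> \<rho> \<theta> \<zeta>)" for \<zeta>
    using imm \<theta> unfolding wasserstein_immersion_def pushforward_tangent_def by (metis someI)
  then show ?thesis
    unfolding pullback_metric_def
    by (intro wasserstein_metric_eq integrable_\<rho> nonneg_\<rho> is_potential_of_weighted_sum \<theta> \<psi>)
qed

lemma pullback_metric_entries:
  assumes imm: "wasserstein_immersion \<Theta> \<rho>" and \<theta>: "\<theta> \<in> \<Theta>"
    and \<psi>: "\<And>k. solves_potential_equation T (\<rho> \<theta>) \<theta> k (\<psi> k)"
  shows "has_bochner_integral M (\<lambda>x. grad (\<psi> i) (T \<theta> x) \<bullet> grad (\<psi> j) (T \<theta> x))
      (pullback_metric \<Theta> \<rho> \<theta> (axis i 1) (axis j 1))" (is ?entries)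
    and "pullback_metric \<Theta> \<rho> \<theta> \<xi> \<eta> =
      (\<Sum>i\<in>UNIV. \<Sum>j\<in>UNIV. \<xi> $ i * (pullback_metric \<Theta> \<rho> \<theta> (axis i 1) (axis j 1) * \<eta> $ j))" (is ?bilinear)
proof -
  have pot: "\<And>k. \<psi> k \<in> potentials (\<rho> \<theta>)"
    using \<psi> unfolding solves_potential_equation_def by blast
  then have C1: "\<And>k. Ck_on 1 UNIV (\<psi> k)" unfolding potentials_def by auto
  note int = potentials_integrable_inner[OF integrable_\<rho>[OF \<theta>] nonneg_\<rho>[OF \<theta>] pot pot]
  \<comment> \<open>The Gram matrix against \<open>\<rho> \<theta>\<close>. The bilinear expansion
    is proved with it first; inserting axis vectors then identifies its entries with values of the
    pullback.\<close>
  define c where "c i j = (\<integral>x. (grad (\<psi> i) x \<bullet> grad (\<psi> j) x) * \<rho> \<theta> x \<partial>lborel)" for i j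
  have expand: "pullback_metric \<Theta> \<rho> \<theta> \<xi> \<eta> = (\<Sum>i\<in>UNIV. \<Sum>j\<in>UNIV. \<xi> $ i * (c i j * \<eta> $ j))" for \<xi> \<eta>
  proof -
    have "pullback_metric \<Theta> \<rho> \<theta> \<xi> \<eta> = (\<integral>x. (\<Sum>i\<in>UNIV. \<Sum>j\<in>UNIV.
        \<xi> $ i * (((grad (\<psi> i) x \<bullet> grad (\<psi> j) x) * \<rho> \<theta> x) * \<eta> $ j)) \<partial>lborel)"
      unfolding pullback_metric_eq[OF imm \<theta> \<psi>] C1_weighted_sum(2)[OF C1]
      by (intro Bochner_Integration.integral_cong refl)
         (simp add: inner_sum_left inner_sum_right sum_distrib_right sum_distrib_left mult_ac,
          subst sum.swap, rule refl)
    also have "\<dots> = (\<Sum>i\<in>UNIV. \<Sum>j\<in>UNIV. \<xi> $ i * (c i j * \<eta> $ j))"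
      by (simp add: Bochner_Integration.integral_sum int c_def del: sum_mult_indicator)
    finally show ?thesis .
  qed
  have delta: "(\<Sum>k\<in>UNIV. axis i 1 $ k * f k) = f i" for i :: 'm and f :: "'m \<Rightarrow> real"
    using inner_axis'[of i 1 "\<chi> k. f k"] by (simp add: inner_vec_def)
  have entry: "pullback_metric \<Theta> \<rho> \<theta> (axis i 1) (axis j 1) = c i j" for i j
    by (simp add: expand delta mult.commute[of _ "axis j 1 $ _"] flip: sum_distrib_left)
  show ?bilinear unfolding entry by (rule expand)
  \<comment> \<open>Change of variables transports both the value and the integrability to
    \<open>M\<close>, as \<open>has_bochner_integral\<close> demands.\<close>
  have "(\<lambda>x. grad (\<psi> i) x \<bullet> grad (\<psi> j) x) \<in> borel_measurable borel"
    using pot by (intro borel_measurable_inner potentials_measurable_grad)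
  from integral_change_of_variables[OF \<theta> this] int[of i j] show ?entries
    by (simp add: has_bochner_integral_iff entry c_def)
qed

end

subsection \<open>The metric tensor\<close>

lemma has_bochner_integral_componentwise:
  fixes f :: "'a \<Rightarrow> 'b::euclidean_space"
  assumes "\<And>b. b \<in> Basis \<Longrightarrow> has_bochner_integral M (\<lambda>x. f x \<bullet> b) (c \<bullet> b)"
  shows "has_bochner_integral M f c"
proof -
  have "has_bochner_integral M (\<lambda>x. \<Sum>b\<in>Basis. (f x \<bullet> b) *\<^sub>R b) (\<Sum>b\<in>Basis. (c \<bullet> b) *\<^sub>R b)"
    by (intro has_bochner_integral_sum has_bochner_integral_scaleR_left assms) auto
  then show ?thesis by (simp add: euclidean_representation)
qed

text \<open>The rows of the Jacobian matrix are the gradients, so multiplying by the transpose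
  yields their Gram matrix.\<close>

lemma jacobian_mult_transpose:
  fixes \<psi> :: "'m::finite \<Rightarrow> real ^ 'd \<Rightarrow> real"
  assumes "\<And>k. \<psi> k differentiable (at x)"
  defines "J \<equiv> jacobian (\<lambda>x. \<chi> k. \<psi> k x) (at x)"
  shows "(J ** transpose J) $ i $ j = grad (\<psi> i) x \<bullet> grad (\<psi> j) x"
proof -
  have "((\<lambda>x. \<chi> k. \<psi> k x) has_derivative (\<lambda>h. \<chi> k. grad (\<psi> k) x \<bullet> h)) (at x)"
    by (subst has_derivative_componentwise_within)
       (auto simp: Basis_vec_def inner_axis intro!: differentiable_has_derivative_grad assms)
  then have "frechet_derivative (\<lambda>x. \<chi> k. \<psi> k x) (at x) = (\<lambda>h. \<chi> k. grad (\<psi> k) x \<bullet> h)"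
    by (rule frechet_derivative_at[symmetric])
  then have "J $ k $ l = grad (\<psi> k) x $ l" for k l
    by (simp add: J_def jacobian_def matrix_def inner_axis)
  then show ?thesis
    by (simp add: matrix_matrix_mult_def transpose_def inner_vec_def)
qed

theorem theorem1:
  fixes \<Theta> :: "(real ^ 'm) set"
    and T :: "real ^ 'm \<Rightarrow> real ^ 'd \<Rightarrow> real ^ 'd"
    and p :: "real ^ 'd \<Rightarrow> real"
    and \<rho> :: "real ^ 'm \<Rightarrow> real ^ 'd \<Rightarrow> real"
    and G :: "real ^ 'm \<Rightarrow> real ^ 'm \<Rightarrow> real ^ 'm \<Rightarrow> real"
    and \<theta> :: "real ^ 'm"
  assumes "open \<Theta>"
    and "\<And>\<theta>. \<theta> \<in> \<Theta> \<Longrightarrow> bij (T \<theta>)"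
    and "smooth_on (\<Theta> \<times> UNIV) (\<lambda>(\<theta>, x). T \<theta> x)"
    and "p \<in> densities" and "\<And>x. p x > 0"
    and "\<And>\<theta>. \<theta> \<in> \<Theta> \<Longrightarrow> integrable (density lborel p) (\<lambda>x. (norm (T \<theta> x))\<^sup>2)"
    and "\<And>\<theta>. \<theta> \<in> \<Theta> \<Longrightarrow> distributed (density lborel p) lborel (T \<theta>) (\<rho> \<theta>)"
    and "isometric_wasserstein_immersion \<Theta> G \<rho>"
    and "\<theta> \<in> \<Theta>"
  shows "(\<forall>\<xi> \<eta>. G \<theta> \<xi> \<eta> = \<xi> \<bullet> (form_matrix (G \<theta>) *v \<eta>)) \<and>
    transpose (form_matrix (G \<theta>)) = form_matrix (G \<theta>) \<and>
    (\<forall>\<xi>. 0 \<le> \<xi> \<bullet> (form_matrix (G \<theta>) *v \<xi>)) \<and>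
    (\<exists>\<psi>. \<forall>k. solves_potential_equation T (\<rho> \<theta>) \<theta> k (\<psi> k)) \<and>
    (\<forall>\<psi>. (\<forall>k. solves_potential_equation T (\<rho> \<theta>) \<theta> k (\<psi> k)) \<longrightarrow>
       (let \<Psi> = (\<lambda>x. \<chi> k. \<psi> k x); J = (\<lambda>x. jacobian \<Psi> (at x)) in
         has_bochner_integral (density lborel p)
           (\<lambda>x. J (T \<theta> x) ** transpose (J (T \<theta> x))) (form_matrix (G \<theta>))) \<and>
       (\<forall>i j. has_bochner_integral (density lborel p)
           (\<lambda>x. grad (\<psi> i) (T \<theta> x) \<bullet> grad (\<psi> j) (T \<theta> x)) (form_matrix (G \<theta>) $ i $ j)))"
proof -
  note \<theta> = \<open>\<theta> \<in> \<Theta>\<close>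
  have imm: "wasserstein_immersion \<Theta> \<rho>" and G: "G \<theta> = pullback_metric \<Theta> \<rho> \<theta>"
    using assms(8) \<theta> by (auto simp: isometric_wasserstein_immersion_def fun_eq_iff)
  have "p \<in> borel_measurable lborel"
    using assms(4) by (auto simp: densities_def)
  then have "emeasure (density lborel p) (space (density lborel p)) = (\<integral>\<^sup>+x. p x \<partial>lborel)"
    by (simp add: emeasure_density)
  also have "\<dots> = 1"
    using assms(4) by (subst nn_integral_eq_integral) (auto simp: densities_def has_bochner_integral_iff)
  finally have fin: "finite_measure (density lborel p)" by (intro finite_measureI) simp
  then interpret pushforward_family \<Theta> T "density lborel p" \<rho>
    using assms(1,2,3,7) imm
    by (intro pushforward_family.intro C1_bijection_family.intro pushforward_family_axioms.intro fin)
       (simp_all add: smooth_on_def wasserstein_immersion_def del: Ck_on.simps One_nat_def)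
  have entries: "form_matrix (G \<theta>) $ i $ j = pullback_metric \<Theta> \<rho> \<theta> (axis i 1) (axis j 1)" for i j
    by (simp add: form_matrix_def G)
  \<comment> \<open>One family of solutions is enough for the properties of
    \<open>G \<theta>\<close> itself; the integral formulas below are proved for every
    family.\<close>
  obtain \<psi> where \<psi>: "\<And>k. solves_potential_equation T (\<rho> \<theta>) \<theta> k (\<psi> k)"
    using ex_solves_potential_equation[OF imm \<theta>] by metis
  have bilinear: "G \<theta> \<xi> \<eta> = \<xi> \<bullet> (form_matrix (G \<theta>) *v \<eta>)" for \<xi> \<eta>
    unfolding inner_vec_def matrix_vector_mult_def
    using pullback_metric_entries(2)[OF imm \<theta> \<psi>, of \<xi> \<eta>] by (simp add: entries[unfolded G] G sum_distrib_left)
  have sym: "transpose (form_matrix (G \<theta>)) = form_matrix (G \<theta>)"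
    by (simp add: vec_eq_iff transpose_def entries pullback_metric_eq[OF imm \<theta> \<psi>] inner_commute)
  have nonneg: "0 \<le> \<xi> \<bullet> (form_matrix (G \<theta>) *v \<xi>)" for \<xi>
  proof -
    \<comment> \<open>On the diagonal the integrand is a squared gradient norm times a nonnegative
      density.\<close>
    have "0 \<le> G \<theta> \<xi> \<xi>"
      unfolding G pullback_metric_eq[OF imm \<theta> \<psi>]
      by (intro Bochner_Integration.integral_nonneg) (simp add: nonneg_\<rho>[OF \<theta>])
    then show ?thesis by (simp only: bilinear)
  qed
  have gram: "has_bochner_integral (density lborel p)
       (\<lambda>x. grad (\<psi> i) (T \<theta> x) \<bullet> grad (\<psi> j) (T \<theta> x)) (form_matrix (G \<theta>) $ i $ j)"
    if "\<And>k. solves_potential_equation T (\<rho> \<theta>) \<theta> k (\<psi> k)" for \<psi> i j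
    unfolding entries by (rule pullback_metric_entries(1)[OF imm \<theta> that])
  have gram_matrix: "has_bochner_integral (density lborel p)
       (\<lambda>x. jacobian (\<lambda>x. \<chi> k. \<psi> k x) (at (T \<theta> x)) ** transpose (jacobian (\<lambda>x. \<chi> k. \<psi> k x) (at (T \<theta> x))))
       (form_matrix (G \<theta>))"
    if \<psi>: "\<And>k. solves_potential_equation T (\<rho> \<theta>) \<theta> k (\<psi> k)" for \<psi>
  proof (rule has_bochner_integral_componentwise)
    fix b :: "real ^ 'm ^ 'm" assume "b \<in> Basis"
    \<comment> \<open>The basis consists of matrix units, and the inner product with one reads off a
      single entry.\<close>
    then obtain i j where b: "b = axis i (axis j 1)" by (auto simp: Basis_vec_def)
    have "\<psi> k differentiable (at x)" for k x
      using \<psi>[of k] by (simp add: solves_potential_equation_def potentials_def)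
    from jacobian_mult_transpose[of \<psi>, OF this] pullback_metric_entries(1)[OF imm \<theta> \<psi>, of i j]
    show "has_bochner_integral (density lborel p)
        (\<lambda>x. (jacobian (\<lambda>x. \<chi> k. \<psi> k x) (at (T \<theta> x)) ** transpose (jacobian (\<lambda>x. \<chi> k. \<psi> k x) (at (T \<theta> x)))) \<bullet> b)
        (form_matrix (G \<theta>) \<bullet> b)"
      by (simp add: b inner_axis entries)
  qed
  show ?thesis
    unfolding Let_def
    by (intro conjI allI impI exI[of _ \<psi>] bilinear sym nonneg \<psi> gram gram_matrix) simp_all
qed

end
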